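(* Let $N\ge 2$ be an integer and consider long-range percolation on the hierarchical lattice $\Omega_N$ with parameters $0\le\alpha<\infty$ and $0<\beta<\infty$. If $\alpha$ and $\beta$ are such that $\theta:=\theta(\alpha,\beta)>0$, then for every $\varepsilon>0$, $$\lim_{k\to\infty}\mathbb P_{\alpha,\beta}\left(|\mathcal C^m_k(0)|>(\theta-\varepsilon)N^k\right)=1 .$$
   Context: For an integer $N\ge 2$, the hierarchical lattice of order $N$ is the countable set $\Omega_N=\{\mathbf x=(x_1,x_2,\ldots): x_i\in\{0,1,\ldots,N-1\},\ \sum_i x_i<\infty\}$ with the (ultra)metric $d(\mathbf x,\mathbf x)=0$ and $d(\mathbf x,\mathbf y)=\max\{i: x_i\ne y_i\}$ for $\mathbf x\ne \mathbf y$. Write $0$ for the all-zero sequence. For $x\in\Omega_N$ and an integer $r\ge 0$, $\mathcal B_r(x)=\{y\in\Omega_N: d(x,y)\le r\}$; it contains $N^r$ vertices. Long-range percolation on $\Omega_N$ with parameters $0\le\alpha<\infty$ and $0<\beta<\infty$: each unordered pair of distinct vertices $x,y\in\Omega_N$ is, independently of all other pairs, joined by an (undirected) edge with probability $p_k=1-\exp(-\alpha/\beta^{k})$, where $k=d(x,y)$. The law is denoted $\mathbb P_{\alpha,\beta}$. The cluster $\mathcal C(x)$ is the connected component of $x$ in the resulting random graph, and $\theta(\alpha,\beta)=\mathbb P_{\alpha,\beta}(|\mathcal C(0)|=\infty)$. For $y\in\mathcal B_n(x)$ (so that $\mathcal B_n(y)=\mathcal B_n(x)$), $\mathcal C_n(y)$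 is the set of vertices connected to $y$ by a path of present edges using only vertices inside $\mathcal B_n(y)$. $\mathcal C_n^m(x)$ is the largest such cluster in $\mathcal B_n(x)$ (ties broken uniformly at random), so $|\mathcal C_n^m(x)|=\max_{y\in\mathcal B_n(x)}|\mathcal C_n(y)|$. *)

theory Defs
  imports "HOL-Probability.Probability"
begin

type_synonym vertex = "nat \<Rightarrow> nat"
type_synonym config = "vertex set \<Rightarrow> bool"

text \<open>Coordinates are indexed by 1, 2, ...; the unused index 0 is pinned to the value 0.\<close>

definition hlattice :: "nat \<Rightarrow> vertex set" where
  "hlattice N = {x. x 0 = 0 \<and> (\<forall>i. x i \<in> {0..N - 1}) \<and> summable (\<lambda>i. real (x i))}"

definition origin :: vertex where
  "origin = (\<lambda>_. 0)"

definition hdist :: "vertex \<Rightarrow> vertex \<Rightarrow> nat" where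
  "hdist x y = (if x = y then 0 else Max {i. x i \<noteq> y i})"

definition hball :: "nat \<Rightarrow> nat \<Rightarrow> vertex \<Rightarrow> vertex set" where
  "hball N r x = {y \<in> hlattice N. hdist x y \<le> r}"

definition pairs :: "nat \<Rightarrow> vertex set set" where
  "pairs N = {{x, y} |x y. x \<in> hlattice N \<and> y \<in> hlattice N \<and> x \<noteq> y}"

definition pair_dist :: "vertex set \<Rightarrow> nat" where
  "pair_dist e = (THE k. \<exists>x y. e = {x, y} \<and> k = hdist x y)"

definition edge_prob :: "real \<Rightarrow> real \<Rightarrow> nat \<Rightarrow> real" where
  "edge_prob \<alpha> \<beta> k = 1 - exp (- (\<alpha> / \<beta> ^ k))"

definition percolation :: "nat \<Rightarrow> real \<Rightarrow> real \<Rightarrow> config measure" where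
  "percolation N \<alpha> \<beta> =
     (\<Pi>\<^sub>M e\<in>pairs N. measure_pmf (bernoulli_pmf (edge_prob \<alpha> \<beta> (pair_dist e))))"

definition edges :: "nat \<Rightarrow> config \<Rightarrow> vertex set set" where
  "edges N \<omega> = {e \<in> pairs N. \<omega> e}"

definition component :: "'a set set \<Rightarrow> 'a \<Rightarrow> 'a set" where
  "component E x = {y. (x, y) \<in> {(u, v). {u, v} \<in> E}\<^sup>*}"

definition cluster :: "nat \<Rightarrow> config \<Rightarrow> vertex \<Rightarrow> vertex set" where
  "cluster N \<omega> x = component (edges N \<omega>) x"

definition ball_cluster :: "nat \<Rightarrow> config \<Rightarrow> nat \<Rightarrow> vertex \<Rightarrow> vertex set" where
  "ball_cluster N \<omega> n y = component {e \<in> edges N \<omega>. e \<subseteq> hball N n y} y"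

definition \<theta> :: "nat \<Rightarrow> real \<Rightarrow> real \<Rightarrow> real" where
  "\<theta> N \<alpha> \<beta> =
     measure (percolation N \<alpha> \<beta>) {\<omega> \<in> space (percolation N \<alpha> \<beta>). infinite (cluster N \<omega> origin)}"

definition largest_clusters :: "nat \<Rightarrow> config \<Rightarrow> nat \<Rightarrow> vertex \<Rightarrow> vertex set set" where
  "largest_clusters N \<omega> n x =
     {C \<in> ball_cluster N \<omega> n ` hball N n x. \<forall>y \<in> hball N n x. card (ball_cluster N \<omega> n y) \<le> card C}"

text \<open>
  The law of the largest cluster of a ball: sample a configuration, then choose uniformly
  among its clusters of maximal size.
\<close>

definition largest_cluster_law ::
    "nat \<Rightarrow> real \<Rightarrow> real \<Rightarrow> nat \<Rightarrow> vertex \<Rightarrow> vertex set measure" where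
  "largest_cluster_law N \<alpha> \<beta> n x =
     percolation N \<alpha> \<beta> \<bind> (\<lambda>\<omega>. measure_pmf (pmf_of_set (largest_clusters N \<omega> n x)))"

text \<open>
  Well-posedness: balls have the expected size, the event defining \<open>\<theta>\<close> is measurable,
  the uniform choice of a largest cluster is over a finite nonempty set, and it is a
  measurable kernel.
\<close>

lemma hdist_commute: "hdist x y = hdist y x"
  by (simp add: hdist_def eq_commute[of "x _"])

lemma pair_dist_insert [simp]: "pair_dist {x, y} = hdist x y"
  unfolding pair_dist_def by (rule the_equality) (auto simp: doubleton_eq_iff hdist_commute)

lemma edge_prob_bounds:
  assumes "0 \<le> \<alpha>" "0 < \<beta>"
  shows "0 \<le> edge_prob \<alpha> \<beta> k" "edge_prob \<alpha> \<beta> k \<le> 1"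
  using assms by (auto simp: edge_prob_def)

lemma hlattice_iff:
  assumes "N \<ge> 1"
  shows "x \<in> hlattice N \<longleftrightarrow> x 0 = 0 \<and> (\<forall>i. x i < N) \<and> finite {i. x i \<noteq> 0}"
proof -
  have "summable (\<lambda>i. real (x i)) \<longleftrightarrow> finite {i. x i \<noteq> 0}"
  proof
    assume "summable (\<lambda>i. real (x i))"
    then have "(\<lambda>i. real (x i)) \<longlonglongrightarrow> 0" by (rule summable_LIMSEQ_zero)
    then have "eventually (\<lambda>i. real (x i) < 1) sequentially"
      by (rule order_tendstoD) simp
    then have "eventually (\<lambda>i. \<not> x i \<noteq> 0) cofinite"
      by (simp add: cofinite_eq_sequentially)
    then show "finite {i. x i \<noteq> 0}" by (simp add: eventually_cofinite)
  next
    assume "finite {i. x i \<noteq> 0}"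
    then show "summable (\<lambda>i. real (x i))" by (rule summable_finite) auto
  qed
  moreover have "k \<in> {0..N - 1} \<longleftrightarrow> k < N" for k using assms by auto
  ultimately show ?thesis by (simp only: hlattice_def mem_Collect_eq)
qed

lemma hball_eq:
  assumes "N \<ge> 1" "x \<in> hlattice N"
  shows "hball N r x = {y. (\<forall>i. i \<notin> {1..r} \<longrightarrow> y i = x i) \<and> (\<forall>i\<in>{1..r}. y i < N)}" (is "_ = ?B")
proof (intro set_eqI iffI)
  fix y assume "y \<in> hball N r x"
  then have y: "y \<in> hlattice N" and d: "hdist x y \<le> r" by (auto simp: hball_def)
  have y': "y 0 = 0" "\<forall>i. y i < N" "finite {i. y i \<noteq> 0}" using y hlattice_iff[OF assms(1)] by auto
  have x': "x 0 = 0" "\<forall>i. x i < N" "finite {i. x i \<noteq> 0}" using assms hlattice_iff[OF assms(1)] by auto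
  have fin: "finite {i. x i \<noteq> y i}"
    by (rule finite_subset[OF _ finite_UnI[OF x'(3) y'(3)]]) auto
  have *: "i \<in> {1..r}" if "x i \<noteq> y i" for i
  proof -
    have "i \<le> Max {i. x i \<noteq> y i}" using fin that by (intro Max_ge) auto
    moreover have "x \<noteq> y" using that by auto
    ultimately have "i \<le> r" using d by (auto simp: hdist_def)
    moreover have "i \<noteq> 0" using that x' y' by (metis)
    ultimately show ?thesis by auto
  qed
  have "y i = x i" if "i \<notin> {1..r}" for i using *[of i] that by argo
  then show "y \<in> ?B" using y' by blast
next
  fix y assume y: "y \<in> ?B"
  have x': "x 0 = 0" "\<forall>i. x i < N" "finite {i. x i \<noteq> 0}" using assms hlattice_iff[OF assms(1)] by auto
  have sub: "{i. x i \<noteq> y i} \<subseteq> {1..r}" using y by force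
  have "finite {i. y i \<noteq> 0}"
    by (rule finite_subset[of _ "{i. x i \<noteq> 0} \<union> {1..r}"]) (use y x'(3) in auto)
  moreover have "y 0 = 0" using y x' by auto
  moreover have "\<forall>i. y i < N" using y x' by (metis (mono_tags, lifting) mem_Collect_eq)
  ultimately have "y \<in> hlattice N" using hlattice_iff[OF assms(1)] by auto
  moreover have "hdist x y \<le> r"
  proof (cases "x = y")
    case False
    then have "{i. x i \<noteq> y i} \<noteq> {}" by auto
    moreover have "finite {i. x i \<noteq> y i}" using sub by (rule finite_subset) simp
    ultimately have "Max {i. x i \<noteq> y i} \<in> {i. x i \<noteq> y i}" by (rule Max_in[rotated])
    then show ?thesis using sub False by (auto simp: hdist_def)
  qed (simp add: hdist_def)
  ultimately show "y \<in> hball N r x" by (simp add: hball_def)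
qed

lemma
  assumes "N \<ge> 1" "x \<in> hlattice N"
  shows finite_hball: "finite (hball N r x)" and card_hball: "card (hball N r x) = N ^ r"
proof -
  let ?g = "\<lambda>f i. if i \<in> {1..r} then f i else x i"
  have img: "hball N r x = ?g ` ({1..r} \<rightarrow>\<^sub>E {..<N})"
  proof (intro set_eqI iffI)
    fix y assume "y \<in> hball N r x"
    then have "y = ?g (restrict y {1..r})" "restrict y {1..r} \<in> {1..r} \<rightarrow>\<^sub>E {..<N}"
      unfolding hball_eq[OF assms] by auto
    then show "y \<in> ?g ` ({1..r} \<rightarrow>\<^sub>E {..<N})" by blast
  next
    fix y assume "y \<in> ?g ` ({1..r} \<rightarrow>\<^sub>E {..<N})"
    then show "y \<in> hball N r x"
      unfolding hball_eq[OF assms] by (auto simp: PiE_iff)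
  qed
  have inj: "inj_on ?g ({1..r} \<rightarrow>\<^sub>E {..<N})"
    by (rule inj_onI, rule PiE_ext, assumption, assumption) metis
  show "finite (hball N r x)" unfolding img by (intro finite_imageI finite_PiE) auto
  show "card (hball N r x) = N ^ r"
    unfolding img card_image[OF inj] by (simp add: card_PiE)
qed

lemma origin_in_hlattice: "N \<ge> 1 \<Longrightarrow> origin \<in> hlattice N"
  by (simp add: hlattice_iff origin_def)

lemma countable_hlattice:
  assumes "N \<ge> 1"
  shows "countable (hlattice N)"
proof (rule countable_subset)
  show "hlattice N \<subseteq> (\<Union>r. hball N r origin)" by (auto simp: hball_def)
  show "countable (\<Union>r. hball N r origin)"
    using finite_hball[OF assms origin_in_hlattice[OF assms]]
    by (intro countable_UN) (auto intro: countable_finite)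
qed

lemma sets_percolation_edge [measurable]:
  "Measurable.pred (percolation N \<alpha> \<beta>) (\<lambda>\<omega>. e \<in> edges N \<omega>)"
proof (cases "e \<in> pairs N")
  case True
  then have "(\<lambda>\<omega>. \<omega> e) \<in> measurable (percolation N \<alpha> \<beta>)
      (measure_pmf (bernoulli_pmf (edge_prob \<alpha> \<beta> (pair_dist e))))"
    unfolding percolation_def by (rule measurable_component_singleton)
  then have "(\<lambda>\<omega>. \<omega> e) \<in> measurable (percolation N \<alpha> \<beta>) (count_space UNIV)"
    by (simp cong: measurable_cong_sets)
  then show ?thesis using True by (simp add: edges_def)
qed (simp add: edges_def)

lemma pred_component:
  assumes N: "N \<ge> 1"
  shows "Measurable.pred (percolation N \<alpha> \<beta>)
           (\<lambda>\<omega>. y \<in> component {e \<in> edges N \<omega>. e \<subseteq> S} x)"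
proof -
  define R where "R = (\<lambda>\<omega>. {(u, v). {u, v} \<in> {e \<in> edges N \<omega>. e \<subseteq> S}})"
  have step: "(x, y) \<in> R \<omega> ^^ Suc n \<longleftrightarrow> (\<exists>z\<in>hlattice N. (x, z) \<in> R \<omega> ^^ n \<and> (z, y) \<in> R \<omega>)" for \<omega> n y
    by (auto simp: relcomp_unfold R_def edges_def pairs_def doubleton_eq_iff)
  have "Measurable.pred (percolation N \<alpha> \<beta>) (\<lambda>\<omega>. (x, y) \<in> R \<omega> ^^ n)" for n y
  proof (induction n arbitrary: y)
    case (Suc n)
    have [measurable]: "Measurable.pred (percolation N \<alpha> \<beta>) (\<lambda>\<omega>. (x, z) \<in> R \<omega> ^^ n)" for z
      by (rule Suc.IH)
    have [measurable]: "Measurable.pred (percolation N \<alpha> \<beta>) (\<lambda>\<omega>. (z, y) \<in> R \<omega>)" for z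
      unfolding R_def mem_Collect_eq prod.case by measurable
    show ?case unfolding step
      by (intro measurable_pred_countable countable_hlattice N) measurable
  qed simp
  then have "Measurable.pred (percolation N \<alpha> \<beta>) (\<lambda>\<omega>. \<exists>n. (x, y) \<in> R \<omega> ^^ n)"
    by measurable
  then show ?thesis by (simp add: component_def rtrancl_power R_def)
qed

lemma component_subset:
  assumes "x \<in> V" "\<Union>E \<subseteq> V"
  shows "component E x \<subseteq> V"
proof
  fix y assume "y \<in> component E x"
  then have "(x, y) \<in> {(u, v). {u, v} \<in> E}\<^sup>*" by (simp add: component_def)
  then show "y \<in> V" by (induction) (use assms in auto)
qed

lemma sets_infinite_cluster:
  assumes N: "N \<ge> 1"
  shows "{\<omega> \<in> space (percolation N \<alpha> \<beta>). infinite (cluster N \<omega> origin)} \<in> sets (percolation N \<alpha> \<beta>)"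
proof -
  let ?F = "{F. finite F \<and> F \<subseteq> hlattice N}"
  have sub: "cluster N \<omega> origin \<subseteq> hlattice N" for \<omega>
    unfolding cluster_def
    by (rule component_subset) (use origin_in_hlattice[OF N] in \<open>auto simp: edges_def pairs_def\<close>)
  have eq: "finite (cluster N \<omega> origin) \<longleftrightarrow>
      (\<exists>F\<in>?F. \<forall>y\<in>hlattice N. y \<in> cluster N \<omega> origin \<longrightarrow> y \<in> F)" for \<omega>
  proof
    assume "finite (cluster N \<omega> origin)"
    then show "\<exists>F\<in>?F. \<forall>y\<in>hlattice N. y \<in> cluster N \<omega> origin \<longrightarrow> y \<in> F" using sub by blast
  next
    assume "\<exists>F\<in>?F. \<forall>y\<in>hlattice N. y \<in> cluster N \<omega> origin \<longrightarrow> y \<in> F"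
    then obtain F where "finite F" "cluster N \<omega> origin \<subseteq> F" using sub[of \<omega>] by blast
    then show "finite (cluster N \<omega> origin)" by (metis finite_subset)
  qed
  have [measurable]: "Measurable.pred (percolation N \<alpha> \<beta>) (\<lambda>\<omega>. y \<in> cluster N \<omega> origin)" for y
    using pred_component[OF N, where S = UNIV] by (simp add: cluster_def)
  have "countable ?F"
    using countable_Collect_finite_subset[OF countable_hlattice[OF N]] by (simp add: conj_commute)
  then have "Measurable.pred (percolation N \<alpha> \<beta>) (\<lambda>\<omega>. finite (cluster N \<omega> origin))"
    unfolding eq
    by (intro measurable_pred_countable countable_hlattice N) measurable
  then have "Measurable.pred (percolation N \<alpha> \<beta>) (\<lambda>\<omega>. infinite (cluster N \<omega> origin))" by measurable
  then show ?thesis by (simp add: pred_def)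
qed

lemma measurable_largest_clusters:
  assumes N: "N \<ge> 1" and x: "x \<in> hlattice N"
  shows "(\<lambda>\<omega>. largest_clusters N \<omega> n x) \<in> measurable (percolation N \<alpha> \<beta>) (count_space UNIV)"
proof -
  let ?M = "percolation N \<alpha> \<beta>"
  let ?B = "hball N n x"
  have fin: "finite ?B" by (rule finite_hball[OF assms])
  have ball: "hball N n y = ?B" if "y \<in> ?B" for y
  proof -
    have "y \<in> hlattice N" using that by (simp add: hball_def)
    then show ?thesis using that
      unfolding hball_eq[OF N x] hball_eq[OF N \<open>y \<in> hlattice N\<close>] by auto
  qed
  have sub: "ball_cluster N \<omega> n y \<subseteq> ?B" if "y \<in> ?B" for \<omega> y
    unfolding ball_cluster_def ball[OF that] by (rule component_subset) (use that in auto)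
  let ?G = "\<lambda>\<omega>. restrict (ball_cluster N \<omega> n) ?B"
  let ?T = "?B \<rightarrow>\<^sub>E Pow ?B"
  have G: "?G \<in> measurable ?M (count_space ?T)"
  proof (rule measurable_count_space_eq_countable[THEN iffD2])
    show "countable ?T" by (intro countable_finite finite_PiE) (auto simp: fin)
    show "?G \<in> space ?M \<rightarrow> ?T \<and> (\<forall>a\<in>?T. ?G -` {a} \<inter> space ?M \<in> sets ?M)"
    proof (intro conjI ballI)
      show "?G \<in> space ?M \<rightarrow> ?T" using sub by auto
    next
      fix a assume a: "a \<in> ?T"
      have eq: "?G \<omega> = a \<longleftrightarrow> (\<forall>y\<in>?B. \<forall>z\<in>?B. z \<in> ball_cluster N \<omega> n y \<longleftrightarrow> z \<in> a y)" for \<omega>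
      proof
        assume *: "\<forall>y\<in>?B. \<forall>z\<in>?B. z \<in> ball_cluster N \<omega> n y \<longleftrightarrow> z \<in> a y"
        have "ball_cluster N \<omega> n y = a y" if "y \<in> ?B" for y
          using * that sub[OF that, of \<omega>] PiE_mem[OF a that] by blast
        then show "?G \<omega> = a" using a by (intro ext) (auto simp: PiE_iff extensional_def)
      qed auto
      have [measurable]: "Measurable.pred ?M (\<lambda>\<omega>. z \<in> ball_cluster N \<omega> n y)" for y z
        unfolding ball_cluster_def by (rule pred_component[OF N])
      have "Measurable.pred ?M (\<lambda>\<omega>. ?G \<omega> = a)"
        unfolding eq by (intro measurable_pred_countable countable_finite[OF fin]) measurable
      moreover have "?G -` {a} \<inter> space ?M = {\<omega> \<in> space ?M. ?G \<omega> = a}" by auto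
      ultimately show "?G -` {a} \<inter> space ?M \<in> sets ?M" by (simp add: pred_def)
    qed
  qed
  let ?h = "\<lambda>g. {C \<in> g ` ?B. \<forall>y\<in>?B. card (g y) \<le> card C}"
  have "?h \<in> measurable (count_space ?T) (count_space UNIV)" by simp
  from measurable_compose[OF G this] show ?thesis
    by (simp add: largest_clusters_def)
qed

lemma largest_cluster_kernel_measurable:
  assumes "N \<ge> 1" "x \<in> hlattice N"
  shows "(\<lambda>\<omega>. measure_pmf (pmf_of_set (largest_clusters N \<omega> n x)))
    \<in> measurable (percolation N \<alpha> \<beta>) (subprob_algebra (count_space UNIV))"
  by (rule measurable_compose[OF measurable_largest_clusters[OF assms]])
     (auto simp: space_subprob_algebra intro!: prob_space_imp_subprob_space prob_space_measure_pmf)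

lemma largest_clusters_finite_nonempty:
  assumes "N \<ge> 1" "x \<in> hlattice N"
  shows "finite (largest_clusters N \<omega> n x)" "largest_clusters N \<omega> n x \<noteq> {}"
proof -
  have fin: "finite (hball N n x)" by (rule finite_hball[OF assms])
  have ne: "hball N n x \<noteq> {}" using assms by (auto simp: hball_def hdist_def)
  show "finite (largest_clusters N \<omega> n x)" using fin by (simp add: largest_clusters_def)
  let ?S = "(\<lambda>y. card (ball_cluster N \<omega> n y)) ` hball N n x"
  have "Max ?S \<in> ?S" using fin ne by (intro Max_in) auto
  then obtain y where y: "y \<in> hball N n x" "card (ball_cluster N \<omega> n y) = Max ?S" by auto
  have "ball_cluster N \<omega> n y \<in> largest_clusters N \<omega> n x"
    unfolding largest_clusters_def using y fin by auto
  then show "largest_clusters N \<omega> n x \<noteq> {}" by blast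
qed

end

theory Submission
  imports Defs
begin

text \<open>
  Put \<open>s = max N \<beta> / N\<close>. The expected number of edges that a vertex sends out of its ball of
  radius \<open>n\<close> is of order \<open>s^-n\<close> if \<open>\<beta> > N\<close>, so a cluster that keeps growing must eventually
  have more than \<open>K s^n\<close> vertices at level \<open>n\<close>, for every \<open>K\<close>: otherwise it would be cut off
  with a probability bounded below infinitely often (if \<open>\<beta> \<le> N\<close>, then \<open>s = 1\<close> and this is trivial). Hence the probability that
  the origin is in such a large cluster has lower limit at least \<open>\<theta>\<close>, which
  already forces \<open>\<beta> < N^2\<close>.

  Now let \<open>k = n + j\<close> with \<open>j\<close> fixed. Different balls of radius \<open>n\<close> are independent, so by Chebyshev's
  inequality the large level-\<open>n\<close> clusters cover a proportion of at least nearly \<open>\<theta>\<close> of the ball of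
  radius \<open>k\<close>, up to an error probability of order \<open>N^-j\<close>. There are at most
  \<open>N^k / (K s^n)\<close> of them. If no cluster at level \<open>k\<close> is as large as claimed, they split into two
  groups, each of volume of order \<open>N^k\<close>, without an edge in between. A given split has probability at most
  \<open>exp (- c (N / s)^k)\<close>, and for \<open>K\<close> large this beats the number
  \<open>2 ^ (N^k / (K s^n))\<close> of splits.
\<close>

subsection \<open>Connected components\<close>

lemma component_refl [simp]: "x \<in> component E x"
  by (simp add: component_def)

lemma component_step: "y \<in> component E x \<Longrightarrow> {y, z} \<in> E \<Longrightarrow> z \<in> component E x"
  unfolding component_def by (auto intro: rtrancl_into_rtrancl)

lemma component_closed:
  assumes "x \<in> A" "\<And>y z. y \<in> A \<Longrightarrow> {y, z} \<in> E \<Longrightarrow> z \<in> A"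
  shows "component E x \<subseteq> A"
proof
  fix y assume "y \<in> component E x"
  then have "(x, y) \<in> {(u, v). {u, v} \<in> E}\<^sup>*" by (simp add: component_def)
  then show "y \<in> A" by (induction) (use assms in auto)
qed

lemma component_eq:
  assumes "y \<in> component E x"
  shows "component E y = component E x"
proof -
  have "sym ({(u, v). {u, v} \<in> E}\<^sup>*)"
    by (rule sym_rtrancl) (auto simp: sym_def insert_commute)
  then show ?thesis
    using assms unfolding component_def by (auto intro: rtrancl_trans dest: symD)
qed

lemma component_mono: "E \<subseteq> E' \<Longrightarrow> component E x \<subseteq> component E' x"
  by (rule component_closed) (auto intro: component_step)

lemma image_component_subset: "f ` component E x \<subseteq> component ((`) f ` E) (f x)"
proof -
  have "component E x \<subseteq> f -` component ((`) f ` E) (f x)"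
  proof (rule component_closed)
    fix y z assume y: "y \<in> f -` component ((`) f ` E) (f x)" and "{y, z} \<in> E"
    then have "f ` {y, z} \<in> (`) f ` E" by blast
    then have "{f y, f z} \<in> (`) f ` E" by simp
    then show "z \<in> f -` component ((`) f ` E) (f x)"
      using y by (auto intro: component_step)
  qed simp
  then show ?thesis by blast
qed

text \<open>An involution is its own inverse, so the reverse inclusion is the forward one for the
  image edge set, pushed forward once more by \<open>f\<close>.\<close>

lemma component_image_involution:
  assumes "\<And>y. f (f y) = y"
  shows "component ((`) f ` E) (f x) = f ` component E x"
proof
  have "(`) f ` (`) f ` E = E" by (simp add: image_image assms)
  then have "f ` component ((`) f ` E) (f x) \<subseteq> component E x"
    using image_component_subset[of f "(`) f ` E" "f x"] by (simp add: assms)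
  then have "f ` f ` component ((`) f ` E) (f x) \<subseteq> f ` component E x" by blast
  then show "component ((`) f ` E) (f x) \<subseteq> f ` component E x"
    by (simp add: image_image assms)
qed (rule image_component_subset)

text \<open>Take a union of classes that is largest among those of size at most \<open>T\<close>.
  Adding a class that it misses overshoots \<open>T\<close>, while that class alone is a competitor
  and hence no larger than the maximum. So the maximum is at least \<open>T / 2\<close>.\<close>

lemma exists_balanced_class_union:
  fixes T :: real
  assumes "finite W" "0 \<le> T" and small: "\<And>c. real (card {x \<in> W. f x = c}) \<le> T"
    and large: "T < real (card W)"
  obtains S where "T / 2 \<le> real (card {x \<in> W. f x \<in> S})" "real (card {x \<in> W. f x \<in> S}) \<le> T"
proof -
  let ?m = "\<lambda>S. card {x \<in> W. f x \<in> S}"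
  \<comment> \<open>The maximum is over the attained sizes, a finite set of numbers, since the index
    sets \<open>S\<close> may be infinitely many.\<close>
  let ?V = "?m ` {S. real (?m S) \<le> T}"
  have "finite ?V"
    by (rule finite_subset[of _ "{..card W}"]) (auto intro!: card_mono assms(1))
  moreover have "?m {} \<in> ?V" using assms(2) by (intro imageI) simp
  ultimately have "Max ?V \<in> ?V" "\<forall>v\<in>?V. v \<le> Max ?V" by (auto intro: Max_in simp del: image_iff)
  then obtain S where S: "real (?m S) \<le> T" and max: "\<And>S'. real (?m S') \<le> T \<Longrightarrow> ?m S' \<le> ?m S"
    by auto
  have "{x \<in> W. f x \<in> S} \<noteq> W" using S large by auto
  then obtain x where x: "x \<in> W" "f x \<notin> S" by blast
  have eq: "{y \<in> W. f y \<in> insert (f x) S} = {y \<in> W. f y \<in> S} \<union> {y \<in> W. f y = f x}" by auto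
  have "?m (insert (f x) S) = ?m S + card {y \<in> W. f y = f x}"
    unfolding eq by (rule card_Un_disjoint) (use assms(1) x in auto)
  moreover have "card {y \<in> W. f y = f x} > 0" using x assms(1) by (auto simp: card_gt_0_iff)
  moreover have "\<not> ?m (insert (f x) S) \<le> ?m S" using calculation by linarith
  ultimately have "T < real (?m S + card {y \<in> W. f y = f x})"
    using max[of "insert (f x) S"] by linarith
  moreover have "card {y \<in> W. f y = f x} \<le> ?m S"
    using max[of "{f x}"] small[of "f x"] by simp
  ultimately have "T / 2 \<le> real (?m S)" by linarith
  with S show thesis using that by blast
qed

text \<open>Packing by volume. It will bound the number of large clusters of a ball, and with it the
  number of ways to split them.\<close>

lemma card_disjoint_large_le:
  assumes "finite B" "\<And>C. C \<in> \<C> \<Longrightarrow> C \<subseteq> B" "\<And>C. C \<in> \<C> \<Longrightarrow> L \<le> real (card C)"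
    and "pairwise disjnt \<C>"
  shows "L * real (card \<C>) \<le> real (card B)"
proof -
  have fin: "finite \<C>" using assms(1,2) by (meson PowI finite_Pow_iff finite_subset subsetI)
  have "L * real (card \<C>) = (\<Sum>C\<in>\<C>. L)" by simp
  also have "\<dots> \<le> (\<Sum>C\<in>\<C>. real (card C))" by (rule sum_mono) (rule assms(3))
  also have "\<dots> = real (card (\<Union>\<C>))"
    using assms fin by (subst card_Union_disjoint) (auto intro: finite_subset)
  also have "\<dots> \<le> real (card B)"
    using assms by (intro of_nat_mono card_mono) auto
  finally show ?thesis .
qed

subsection \<open>Balls and clusters in the hierarchical lattice\<close>

locale hierarchical_percolation =
  fixes N :: nat and \<alpha> \<beta> :: real
  assumes N: "N \<ge> 2" and \<alpha>: "0 \<le> \<alpha>" and \<beta>: "0 < \<beta>"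
begin

abbreviation "P \<equiv> percolation N \<alpha> \<beta>"

lemma N1: "N \<ge> 1" using N by simp

lemma origin [simp]: "origin \<in> hlattice N"
  by (rule origin_in_hlattice[OF N1])

lemma hdist_le_iff:
  assumes "x \<in> hlattice N" "y \<in> hlattice N"
  shows "hdist x y \<le> r \<longleftrightarrow> (\<forall>i>r. x i = y i)"
proof (cases "x = y")
  case False
  have "finite {i. x i \<noteq> 0}" "finite {i. y i \<noteq> 0}"
    using assms hlattice_iff[OF N1] by auto
  then have "finite {i. x i \<noteq> y i}"
    by (rule finite_subset[OF _ finite_UnI, rotated]) auto
  moreover have "{i. x i \<noteq> y i} \<noteq> {}" using False by auto
  ultimately have "Max {i. x i \<noteq> y i} \<le> r \<longleftrightarrow> (\<forall>i\<in>{i. x i \<noteq> y i}. i \<le> r)"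
    by (rule Max_le_iff)
  then show ?thesis using False by (auto simp: hdist_def not_less[symmetric])
qed (simp add: hdist_def)

lemma mem_hball_iff:
  "x \<in> hlattice N \<Longrightarrow> y \<in> hball N r x \<longleftrightarrow> y \<in> hlattice N \<and> (\<forall>i>r. x i = y i)"
  by (auto simp: hball_def hdist_le_iff)

lemma hball_self: "x \<in> hlattice N \<Longrightarrow> x \<in> hball N r x"
  by (simp add: mem_hball_iff)

lemma hball_subset_hlattice: "hball N r x \<subseteq> hlattice N"
  by (auto simp: hball_def)

text \<open>The distance is an ultrametric: lying in a common ball means agreeing in all coordinates
  beyond \<open>r\<close>, an equivalence relation, so each point of a ball is a centre.\<close>

lemma hball_eq_hball:
  assumes "x \<in> hlattice N" "y \<in> hball N r x"
  shows "hball N r y = hball N r x"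
proof -
  have "y \<in> hlattice N" using assms by (simp add: mem_hball_iff)
  then show ?thesis using assms by (auto simp: mem_hball_iff)
qed

lemma hball_mono: "r \<le> s \<Longrightarrow> hball N r x \<subseteq> hball N s x"
  by (auto simp: hball_def)

lemma hlattice_exhausted:
  assumes "finite F" "F \<subseteq> hlattice N"
  obtains r where "F \<subseteq> hball N r origin"
proof
  show "F \<subseteq> hball N (Max (hdist origin ` F)) origin"
    using assms by (auto simp: hball_def)
qed

lemma hball_disjoint:
  assumes "x \<in> hlattice N" "y \<in> hlattice N" "y \<notin> hball N r x"
  shows "hball N r x \<inter> hball N r y = {}"
  using assms by (auto simp: mem_hball_iff)

text \<open>Seen from anywhere in the inner ball, all vertices of one annulus are equally far away,
  so the edge rate is constant on an annulus.\<close>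

lemma hdist_annulus:
  assumes "x \<in> hball N n origin" "y \<in> hball N (Suc m) origin - hball N m origin" "n \<le> m"
  shows "hdist x y = Suc m"
proof -
  have xy: "x \<in> hlattice N" "y \<in> hlattice N" using assms hball_subset_hlattice by auto
  have "x \<in> hball N m origin" using assms hball_mono by blast
  then have "hball N m origin = hball N m x" using hball_eq_hball[of origin x m] by simp
  then have "\<not> hdist x y \<le> m" using assms xy by (auto simp: hball_def)
  moreover have "hball N (Suc m) x = hball N (Suc m) origin"
    using assms hball_mono[of n "Suc m"] by (intro hball_eq_hball) auto
  then have "hdist x y \<le> Suc m" using assms by (auto simp: hball_def)
  ultimately show ?thesis by simp
qed

section \<open>Clusters confined to a ball as functions of finitely many edges\<close>

definition ball_pairs :: "nat \<Rightarrow> vertex \<Rightarrow> vertex set set" where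
  "ball_pairs n x = pairs N \<inter> Pow (hball N n x)"

lemma ball_pairs_subset: "ball_pairs n x \<subseteq> pairs N"
  by (simp add: ball_pairs_def)

lemma finite_ball_pairs: "x \<in> hlattice N \<Longrightarrow> finite (ball_pairs n x)"
  by (simp add: ball_pairs_def finite_hball[OF N1])

text \<open>This form shows that the cluster depends on the configuration only through its edges in
  \<open>ball_pairs n x\<close>, which is what measurability and independence arguments
  require.\<close>

lemma ball_cluster_alt: "ball_cluster N \<omega> n x = component (edges N \<omega> \<inter> ball_pairs n x) x"
  unfolding ball_cluster_def by (rule arg_cong[of _ _ "\<lambda>E. component E x"])
    (auto simp: ball_pairs_def edges_def)

lemma component_ball_subset:
  assumes "x \<in> hlattice N"
  shows "component (E \<inter> ball_pairs n x) x \<subseteq> hball N n x"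
  by (rule component_subset) (auto simp: ball_pairs_def hball_self assms)

lemma ball_cluster_subset: "x \<in> hlattice N \<Longrightarrow> ball_cluster N \<omega> n x \<subseteq> hball N n x"
  unfolding ball_cluster_alt by (rule component_ball_subset)

lemma finite_ball_cluster: "x \<in> hlattice N \<Longrightarrow> finite (ball_cluster N \<omega> n x)"
  by (rule finite_subset[OF ball_cluster_subset finite_hball[OF N1]])

lemma ball_cluster_self [simp]: "x \<in> ball_cluster N \<omega> n x"
  by (simp add: ball_cluster_def)

lemma ball_pairs_mono: "n \<le> m \<Longrightarrow> ball_pairs n x \<subseteq> ball_pairs m x"
  using hball_mono[of n m x] by (auto simp: ball_pairs_def)

lemma ball_cluster_mono: "n \<le> m \<Longrightarrow> ball_cluster N \<omega> n x \<subseteq> ball_cluster N \<omega> m x"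
  unfolding ball_cluster_alt by (rule component_mono) (use ball_pairs_mono in blast)

lemma ball_cluster_eq:
  assumes "x \<in> hlattice N" "y \<in> ball_cluster N \<omega> n x"
  shows "ball_cluster N \<omega> n y = ball_cluster N \<omega> n x"
proof -
  have "y \<in> hball N n x" using assms ball_cluster_subset by blast
  then have "ball_pairs n y = ball_pairs n x"
    using hball_eq_hball[OF assms(1)] by (simp add: ball_pairs_def)
  then show ?thesis using assms component_eq by (simp add: ball_cluster_alt)
qed

lemma cluster_subset_hlattice: "cluster N \<omega> origin \<subseteq> hlattice N"
  unfolding cluster_def by (rule component_subset) (auto simp: edges_def pairs_def)

text \<open>Both endpoints of a present edge lie in some ball around the origin, so the increasing
  union of the confined clusters is closed under present edges.\<close>

lemma cluster_eq_UN_ball_cluster: "cluster N \<omega> origin = (\<Union>n. ball_cluster N \<omega> n origin)"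
proof
  show "cluster N \<omega> origin \<subseteq> (\<Union>n. ball_cluster N \<omega> n origin)"
    unfolding cluster_def
  proof (rule component_closed)
    show "origin \<in> (\<Union>n. ball_cluster N \<omega> n origin)" by simp
  next
    fix y z assume y: "y \<in> (\<Union>n. ball_cluster N \<omega> n origin)" and e: "{y, z} \<in> edges N \<omega>"
    then obtain n where n: "y \<in> ball_cluster N \<omega> n origin" by blast
    have "{y, z} \<subseteq> hlattice N" using e by (auto simp: edges_def pairs_def doubleton_eq_iff)
    then obtain m where m: "{y, z} \<subseteq> hball N m origin" using hlattice_exhausted[of "{y, z}"] by blast
    have "{y, z} \<in> edges N \<omega> \<inter> ball_pairs (max n m) origin"
      using e m hball_mono[of m "max n m"] by (auto simp: ball_pairs_def edges_def)
    moreover have "y \<in> ball_cluster N \<omega> (max n m) origin"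
      using n ball_cluster_mono[of n "max n m"] by auto
    ultimately have "z \<in> ball_cluster N \<omega> (max n m) origin"
      unfolding ball_cluster_alt by (blast intro: component_step)
    then show "z \<in> (\<Union>n. ball_cluster N \<omega> n origin)" by blast
  qed
  show "(\<Union>n. ball_cluster N \<omega> n origin) \<subseteq> cluster N \<omega> origin"
    unfolding cluster_def ball_cluster_alt by (intro UN_least component_mono Int_lower1)
qed

text \<open>Writes the event of an infinite cluster as a decreasing intersection over
  \<open>m\<close> of increasing unions over \<open>n\<close> of events that depend on finitely many
  edges, ready for continuity of the measure.\<close>

lemma infinite_cluster_iff:
  "infinite (cluster N \<omega> origin) \<longleftrightarrow> (\<forall>m. \<exists>n. \<not> ball_cluster N \<omega> n origin \<subseteq> hball N m origin)"
proof -
  have "finite (cluster N \<omega> origin) \<longleftrightarrow> (\<exists>m. cluster N \<omega> origin \<subseteq> hball N m origin)"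
    using hlattice_exhausted[OF _ cluster_subset_hlattice] finite_hball[OF N1 origin] finite_subset
    by metis
  then show ?thesis unfolding cluster_eq_UN_ball_cluster by blast
qed

text \<open>Translations of the lattice modulo \<open>N\<close> would also do, but this map is an involution.\<close>

definition swap :: "vertex \<Rightarrow> vertex \<Rightarrow> vertex" where
  "swap x y = (\<lambda>i. Transposition.transpose 0 (x i) (y i))"

lemma swap_swap [simp]: "swap x (swap x y) = y"
  by (simp add: swap_def)

lemma swap_origin [simp]: "swap x origin = x"
  by (simp add: swap_def origin_def)

lemma swap_eq_iff [simp]: "swap x y = swap x z \<longleftrightarrow> y = z"
  using swap_swap by metis

lemma hdist_swap [simp]: "hdist (swap x y) (swap x z) = hdist y z"
proof -
  have "swap x y i = swap x z i \<longleftrightarrow> y i = z i" for i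
    unfolding swap_def by (metis transpose_involutory)
  then show ?thesis by (simp add: hdist_def)
qed

lemma swap_in_hlattice:
  assumes "x \<in> hlattice N" "y \<in> hlattice N"
  shows "swap x y \<in> hlattice N"
proof -
  have "{i. swap x y i \<noteq> 0} \<subseteq> {i. x i \<noteq> 0} \<union> {i. y i \<noteq> 0}"
    by (auto simp: swap_def transpose_def split: if_splits)
  then have fin: "finite {i. swap x y i \<noteq> 0}"
    using assms by (auto simp: hlattice_iff[OF N1] intro: finite_subset)
  have "\<forall>i. x i < N" "\<forall>i. y i < N" using assms by (auto simp: hlattice_iff[OF N1])
  then have "swap x y i < N" for i
    using N1 by (cases "y i = 0"; cases "y i = x i") (auto simp: swap_def transpose_def)
  moreover have "swap x y 0 = 0" using assms by (simp add: hlattice_iff[OF N1] swap_def)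
  ultimately show ?thesis using fin by (simp add: hlattice_iff[OF N1])
qed

lemma swap_in_hlattice_iff: "x \<in> hlattice N \<Longrightarrow> swap x y \<in> hlattice N \<longleftrightarrow> y \<in> hlattice N"
  using swap_in_hlattice[of x "swap x y"] swap_in_hlattice[of x y] by auto

lemma swap_mem_hball_iff:
  assumes "x \<in> hlattice N"
  shows "swap x y \<in> hball N n x \<longleftrightarrow> y \<in> hball N n origin"
  using hdist_swap[of x origin y] swap_in_hlattice_iff[OF assms] by (simp add: hball_def)

lemma swap_image_in_pairs:
  assumes "x \<in> hlattice N" "e \<in> pairs N"
  shows "swap x ` e \<in> pairs N" "pair_dist (swap x ` e) = pair_dist e"
proof -
  obtain u v where e: "e = {u, v}" "u \<in> hlattice N" "v \<in> hlattice N" "u \<noteq> v"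
    using assms(2) by (auto simp: pairs_def)
  have "swap x u \<in> hlattice N" "swap x v \<in> hlattice N" "swap x u \<noteq> swap x v"
    using e assms(1) swap_in_hlattice by auto
  then show "swap x ` e \<in> pairs N" unfolding pairs_def e(1) image_insert image_empty by blast
  show "pair_dist (swap x ` e) = pair_dist e" by (simp add: e(1))
qed

lemma swap_image_swap_image [simp]: "swap x ` swap x ` A = A"
  by (simp add: image_image)

text \<open>\<open>swap x\<close> exchanges the origin and \<open>x\<close> and carries the ball of
  the one to that of the other. The relabelled configuration is restricted to \<open>pairs N\<close>
  so that it is a point of the product space.\<close>

lemma ball_cluster_swap:
  assumes x: "x \<in> hlattice N"
  shows "ball_cluster N (\<lambda>e\<in>pairs N. \<omega> (swap x ` e)) n origin = swap x ` ball_cluster N \<omega> n x"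
proof -
  let ?E = "edges N \<omega> \<inter> ball_pairs n x"
  let ?E' = "edges N (\<lambda>e\<in>pairs N. \<omega> (swap x ` e)) \<inter> ball_pairs n origin"
  have mem: "swap x ` e \<in> ?E \<longleftrightarrow> e \<in> ?E'" for e
  proof -
    have "swap x ` e \<in> pairs N \<longleftrightarrow> e \<in> pairs N"
      using swap_image_in_pairs(1)[OF x] swap_image_swap_image[of x e] by metis
    moreover have "swap x ` e \<subseteq> hball N n x \<longleftrightarrow> e \<subseteq> hball N n origin"
      unfolding image_subset_iff using swap_mem_hball_iff[OF x] by (simp add: subset_eq)
    ultimately show ?thesis
      unfolding edges_def ball_pairs_def by (cases "e \<in> pairs N") simp_all
  qed
  have "?E' = (`) (swap x) ` ?E"
  proof (intro set_eqI iffI)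
    fix e assume "e \<in> ?E'"
    then have "swap x ` e \<in> ?E" using mem by blast
    then show "e \<in> (`) (swap x) ` ?E" by (metis imageI swap_image_swap_image)
  next
    fix e assume "e \<in> (`) (swap x) ` ?E"
    then show "e \<in> ?E'" using mem[of e] by auto
  qed
  moreover have "origin = swap x x" by (metis swap_origin swap_swap)
  ultimately show ?thesis
    unfolding ball_cluster_alt using component_image_involution[of "swap x" ?E x] by simp
qed

subsection \<open>Independence and symmetry\<close>

sublocale prob_space P
  unfolding percolation_def by (intro prob_space_PiM prob_space_measure_pmf)

section \<open>Finite-dimensional laws and independence of disjoint edge sets\<close>

abbreviation edge_weight :: "vertex set \<Rightarrow> real" where
  "edge_weight e \<equiv> edge_prob \<alpha> \<beta> (pair_dist e)"

text \<open>The product formula for finitely many edges; the independence statements below are all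
  derived from it.\<close>

lemma prob_edges_Int_eq:
  assumes I: "finite I" "I \<subseteq> pairs N" and a: "a \<subseteq> I"
  shows "prob {\<omega> \<in> space P. edges N \<omega> \<inter> I = a} = (\<Prod>e\<in>I. if e \<in> a then edge_weight e else 1 - edge_weight e)"
proof -
  interpret X: product_prob_space "\<lambda>e. measure_pmf (bernoulli_pmf (edge_weight e))" "pairs N"
    by unfold_locales
  have eq: "{\<omega> \<in> space P. edges N \<omega> \<inter> I = a} = {\<omega> \<in> space P. \<forall>e\<in>I. \<omega> e \<in> {e \<in> a}}"
    using I(2) a unfolding edges_def by blast
  have "emeasure P {\<omega> \<in> space P. edges N \<omega> \<inter> I = a} =
      (\<Prod>e\<in>I. emeasure (measure_pmf (bernoulli_pmf (edge_weight e))) {e \<in> a})"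
    unfolding eq unfolding percolation_def by (rule X.emeasure_PiM_Collect) (use I in auto)
  also have "\<dots> = (\<Prod>e\<in>I. ennreal (if e \<in> a then edge_weight e else 1 - edge_weight e))"
    using edge_prob_bounds[OF \<alpha> \<beta>]
    by (intro prod.cong refl) (auto simp: emeasure_pmf_single)
  also have "\<dots> = ennreal (\<Prod>e\<in>I. if e \<in> a then edge_weight e else 1 - edge_weight e)"
    using edge_prob_bounds[OF \<alpha> \<beta>] by (intro prod_ennreal) auto
  finally show ?thesis
    using edge_prob_bounds[OF \<alpha> \<beta>]
    by (subst measure_def) (simp, intro enn2real_ennreal prod_nonneg, simp)
qed

lemma measurable_edges_Int:
  assumes "finite I"
  shows "(\<lambda>\<omega>. edges N \<omega> \<inter> I) \<in> measurable P (count_space UNIV)"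
proof -
  have "(\<lambda>\<omega>. edges N \<omega> \<inter> I) \<in> measurable P (count_space (Pow I))"
  proof (rule measurable_count_space_eq_countable[THEN iffD2])
    show "countable (Pow I)" using assms by (simp add: countable_finite)
    have "(\<lambda>\<omega>. edges N \<omega> \<inter> I) -` {a} \<inter> space P \<in> sets P" if "a \<subseteq> I" for a
    proof -
      have "Measurable.pred P (\<lambda>\<omega>. \<forall>e\<in>I. e \<in> edges N \<omega> \<longleftrightarrow> e \<in> a)"
        by (intro measurable_pred_countable countable_finite assms) measurable
      moreover have "(\<lambda>\<omega>. edges N \<omega> \<inter> I) -` {a} \<inter> space P =
          {\<omega> \<in> space P. \<forall>e\<in>I. e \<in> edges N \<omega> \<longleftrightarrow> e \<in> a}" using that by auto
      ultimately show ?thesis by (simp add: pred_def)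
    qed
    then show "(\<lambda>\<omega>. edges N \<omega> \<inter> I) \<in> space P \<rightarrow> Pow I \<and>
        (\<forall>a\<in>Pow I. (\<lambda>\<omega>. edges N \<omega> \<inter> I) -` {a} \<inter> space P \<in> sets P)" by auto
  qed
  from measurable_compose[OF this, of "\<lambda>a. a" "count_space UNIV"] show ?thesis by simp
qed

lemma event_edges_Int:
  assumes "finite I"
  shows "{\<omega> \<in> space P. Q (edges N \<omega> \<inter> I)} \<in> events"
proof -
  have "Measurable.pred P (\<lambda>\<omega>. Q (edges N \<omega> \<inter> I))"
    by (rule measurable_compose[OF measurable_edges_Int[OF assms]]) simp
  then show ?thesis by (simp add: pred_def)
qed

lemma event_edges_Int_Int:
  assumes "finite I" "finite J"
  shows "{\<omega> \<in> space P. R (edges N \<omega> \<inter> I) (edges N \<omega> \<inter> J)} \<in> events"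
proof -
  have *: "\<omega> \<inter> (I \<union> J) \<inter> I = \<omega> \<inter> I" "\<omega> \<inter> (I \<union> J) \<inter> J = \<omega> \<inter> J" for \<omega> :: "vertex set set"
    by auto
  show ?thesis
    using event_edges_Int[of "I \<union> J" "\<lambda>a. R (a \<inter> I) (a \<inter> J)"] assms by (simp add: *)
qed

lemma prob_edges_Int_eq_indep:
  assumes I: "finite I" "I \<subseteq> pairs N" and J: "finite J" "J \<subseteq> pairs N" and "I \<inter> J = {}"
    and a: "a \<subseteq> I"
  shows "prob {\<omega> \<in> space P. edges N \<omega> \<inter> I = a \<and> R (edges N \<omega> \<inter> J)} =
    prob {\<omega> \<in> space P. edges N \<omega> \<inter> I = a} * prob {\<omega> \<in> space P. R (edges N \<omega> \<inter> J)}"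
proof -
  have 1: "prob {\<omega> \<in> space P. edges N \<omega> \<inter> I = a \<and> edges N \<omega> \<inter> J = b} =
    prob {\<omega> \<in> space P. edges N \<omega> \<inter> I = a} * prob {\<omega> \<in> space P. edges N \<omega> \<inter> J = b}"
    if b: "b \<subseteq> J" for b
  proof -
    let ?w = "\<lambda>a e. if e \<in> a then edge_weight e else 1 - edge_weight e"
    have "{\<omega> \<in> space P. edges N \<omega> \<inter> I = a \<and> edges N \<omega> \<inter> J = b} =
        {\<omega> \<in> space P. edges N \<omega> \<inter> (I \<union> J) = a \<union> b}"
      using a b \<open>I \<inter> J = {}\<close> by blast
    then have "prob {\<omega> \<in> space P. edges N \<omega> \<inter> I = a \<and> edges N \<omega> \<inter> J = b} = (\<Prod>e\<in>I\<union>J. ?w (a \<union> b) e)"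
      using I J Un_mono[OF a b] by (subst prob_edges_Int_eq[symmetric]) auto
    also have "\<dots> = (\<Prod>e\<in>I. ?w (a \<union> b) e) * (\<Prod>e\<in>J. ?w (a \<union> b) e)"
      using I J \<open>I \<inter> J = {}\<close> by (intro prod.union_disjoint)
    also have "(\<Prod>e\<in>I. ?w (a \<union> b) e) = (\<Prod>e\<in>I. ?w a e)"
      using b \<open>I \<inter> J = {}\<close> by (intro prod.cong) auto
    also have "(\<Prod>e\<in>J. ?w (a \<union> b) e) = (\<Prod>e\<in>J. ?w b e)"
      using a \<open>I \<inter> J = {}\<close> by (intro prod.cong) auto
    finally show ?thesis using prob_edges_Int_eq I J a b by simp
  qed
  let ?B = "{b \<in> Pow J. R b}"
  have fin: "finite ?B" using J by simp
  have "prob {\<omega> \<in> space P. edges N \<omega> \<inter> I = a \<and> R (edges N \<omega> \<inter> J)} =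
      (\<Sum>b\<in>?B. prob {\<omega> \<in> space P. edges N \<omega> \<inter> I = a \<and> edges N \<omega> \<inter> J = b})"
    by (rule prob_sum[OF fin]) (use I J in \<open>auto intro!: event_edges_Int_Int\<close>)
  also have "\<dots> = (\<Sum>b\<in>?B. prob {\<omega> \<in> space P. edges N \<omega> \<inter> I = a} * prob {\<omega> \<in> space P. edges N \<omega> \<inter> J = b})"
    by (rule sum.cong) (use 1 in auto)
  also have "\<dots> = prob {\<omega> \<in> space P. edges N \<omega> \<inter> I = a} * (\<Sum>b\<in>?B. prob {\<omega> \<in> space P. edges N \<omega> \<inter> J = b})"
    by (simp add: sum_distrib_left)
  also have "(\<Sum>b\<in>?B. prob {\<omega> \<in> space P. edges N \<omega> \<inter> J = b}) = prob {\<omega> \<in> space P. R (edges N \<omega> \<inter> J)}"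
    by (rule prob_sum[OF fin, symmetric]) (use J in \<open>auto intro!: event_edges_Int\<close>)
  finally show ?thesis .
qed

text \<open>Conditioning on the edges in \<open>I\<close>, as a finite sum over their possible
  states. The event for the edges in \<open>J\<close> may vary with the revealed state
  \<open>a\<close>; this allows it to refer to clusters that \<open>a\<close> determines.\<close>

lemma prob_edges_condition:
  assumes I: "finite I" "I \<subseteq> pairs N" and J: "finite J" "J \<subseteq> pairs N" and "I \<inter> J = {}"
  shows "prob {\<omega> \<in> space P. R (edges N \<omega> \<inter> I) (edges N \<omega> \<inter> J)} =
    (\<Sum>a\<in>Pow I. prob {\<omega> \<in> space P. edges N \<omega> \<inter> I = a} * prob {\<omega> \<in> space P. R a (edges N \<omega> \<inter> J)})"
proof -
  have "prob {\<omega> \<in> space P. R (edges N \<omega> \<inter> I) (edges N \<omega> \<inter> J)} =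
      (\<Sum>a\<in>Pow I. prob {\<omega> \<in> space P. edges N \<omega> \<inter> I = a \<and> R a (edges N \<omega> \<inter> J)})"
    by (rule prob_sum) (use I J in \<open>auto intro!: event_edges_Int_Int\<close>)
  also have "\<dots> = (\<Sum>a\<in>Pow I. prob {\<omega> \<in> space P. edges N \<omega> \<inter> I = a} * prob {\<omega> \<in> space P. R a (edges N \<omega> \<inter> J)})"
    by (rule sum.cong) (use prob_edges_Int_eq_indep[OF assms] in auto)
  finally show ?thesis .
qed

lemma sum_prob_edges_Int_eq:
  assumes I: "finite I" "I \<subseteq> pairs N"
  shows "prob {\<omega> \<in> space P. Q (edges N \<omega> \<inter> I)} =
    (\<Sum>a\<in>Pow I. prob {\<omega> \<in> space P. edges N \<omega> \<inter> I = a} * of_bool (Q a))"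
proof -
  have "prob {\<omega> \<in> space P. Q a} = of_bool (Q a)" for a by (cases "Q a") (auto simp: prob_space)
  then show ?thesis using prob_edges_condition[OF I, of "{}" "\<lambda>a _. Q a"] by simp
qed

lemma prob_edges_indep:
  assumes I: "finite I" "I \<subseteq> pairs N" and J: "finite J" "J \<subseteq> pairs N" and "I \<inter> J = {}"
  shows "prob {\<omega> \<in> space P. Q (edges N \<omega> \<inter> I) \<and> R (edges N \<omega> \<inter> J)} =
    prob {\<omega> \<in> space P. Q (edges N \<omega> \<inter> I)} * prob {\<omega> \<in> space P. R (edges N \<omega> \<inter> J)}"
proof -
  have "prob {\<omega> \<in> space P. Q a \<and> R (edges N \<omega> \<inter> J)} =
      of_bool (Q a) * prob {\<omega> \<in> space P. R (edges N \<omega> \<inter> J)}" for a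
    by (cases "Q a") auto
  then show ?thesis
    unfolding prob_edges_condition[OF assms, of "\<lambda>a b. Q a \<and> R b"]
      sum_prob_edges_Int_eq[OF I, of Q] by (simp add: sum_distrib_right mult.assoc)
qed

text \<open>Because an edge is absent with probability \<open>exp (- rate)\<close>, the absence of a
  whole set of edges is controlled by the sum of their rates.\<close>

lemma prob_closed:
  assumes "finite D" "D \<subseteq> pairs N"
  shows "prob {\<omega> \<in> space P. edges N \<omega> \<inter> D = {}} = exp (- (\<Sum>e\<in>D. \<alpha> / \<beta> ^ pair_dist e))"
  using prob_edges_Int_eq[OF assms empty_subsetI] assms(1)
  by (simp add: edge_prob_def exp_sum sum_negf[symmetric])

lemma event_ball_cluster:
  assumes "x \<in> hlattice N"
  shows "{\<omega> \<in> space P. Q (ball_cluster N \<omega> n x)} \<in> events"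
  unfolding ball_cluster_alt using event_edges_Int[OF finite_ball_pairs[OF assms]] .

text \<open>\<open>swap x\<close> permutes the pairs and keeps their distances, hence their edge
  probabilities; permuting coordinates with equal laws preserves a product measure.\<close>

lemma distr_swap:
  assumes x: "x \<in> hlattice N"
  shows "distr P P (\<lambda>\<omega>. \<lambda>e\<in>pairs N. \<omega> (swap x ` e)) = P"
proof -
  let ?M = "\<lambda>e. measure_pmf (bernoulli_pmf (edge_weight e))"
  have eq: "(\<Pi>\<^sub>M e\<in>pairs N. ?M (swap x ` e)) = P"
    unfolding percolation_def by (intro PiM_cong refl) (simp add: swap_image_in_pairs[OF x])
  have inj: "inj_on ((`) (swap x)) (pairs N)"
    by (rule inj_on_inverseI[of _ "(`) (swap x)"]) simp
  have "distr (PiM (pairs N) ?M) (\<Pi>\<^sub>M e\<in>pairs N. ?M (swap x ` e)) (\<lambda>\<omega>. \<lambda>e\<in>pairs N. \<omega> (swap x ` e)) =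
      (\<Pi>\<^sub>M e\<in>pairs N. ?M (swap x ` e))"
    by (rule distr_PiM_reindex[OF prob_space_measure_pmf inj]) (use swap_image_in_pairs[OF x] in auto)
  then show ?thesis unfolding eq by (simp add: percolation_def)
qed

text \<open>Homogeneity of the model. Only the size is considered, because the symmetry moves the
  cluster itself but preserves its cardinality.\<close>

lemma prob_card_ball_cluster:
  assumes x: "x \<in> hlattice N"
  shows "prob {\<omega> \<in> space P. Q (card (ball_cluster N \<omega> n x))} =
    prob {\<omega> \<in> space P. Q (card (ball_cluster N \<omega> n origin))}"
proof -
  let ?F = "\<lambda>\<omega>. \<lambda>e\<in>pairs N. \<omega> (swap x ` e)"
  let ?A = "{\<omega> \<in> space P. Q (card (ball_cluster N \<omega> n origin))}"
  have F: "?F \<in> measurable P P"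
    unfolding percolation_def
    by (intro measurable_restrict) (simp cong: measurable_cong_sets add: swap_image_in_pairs[OF x])
  have "prob ?A = measure (distr P P ?F) ?A" using distr_swap[OF x] by simp
  also have "\<dots> = prob (?F -` ?A \<inter> space P)"
    by (rule measure_distr[OF F]) (rule event_ball_cluster[OF origin])
  also have "?F -` ?A \<inter> space P = {\<omega> \<in> space P. Q (card (ball_cluster N \<omega> n x))}"
  proof -
    have "card (swap x ` C) = card C" for C by (rule card_image) (simp add: inj_on_def)
    then show ?thesis using measurable_space[OF F] by (auto simp: ball_cluster_swap[OF x])
  qed
  finally show ?thesis by simp
qed

subsection \<open>Growth of the infinite cluster\<close>

text \<open>The annulus at distance \<open>k\<close> has at most \<open>N ^ k\<close> vertices of
  rate \<open>\<alpha> / \<beta> ^ k\<close> each. The right-hand side is the exact partial sum of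
  the resulting geometric series, in telescoping form so that the induction on \<open>M\<close>
  closes.\<close>

lemma sum_rates_annulus_le:
  assumes "N < \<beta>" "x \<in> hball N n origin" "n \<le> M"
  shows "(\<Sum>y\<in>hball N M origin - hball N n origin. \<alpha> / \<beta> ^ hdist x y)
    \<le> \<alpha> * (N / (\<beta> - N)) * ((N / \<beta>) ^ n - (N / \<beta>) ^ M)"
  using \<open>n \<le> M\<close>
proof (induction M rule: dec_induct)
  case base
  show ?case by simp
next
  case (step m)
  let ?S = "\<lambda>k. hball N k origin"
  have fin: "finite (?S k)" for k by (rule finite_hball[OF N1 origin])
  have eq: "?S (Suc m) - ?S n = (?S m - ?S n) \<union> (?S (Suc m) - ?S m)"
    using hball_mono[of n m origin] hball_mono[of m "Suc m" origin] step by auto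
  have "(\<Sum>y\<in>?S (Suc m) - ?S m. \<alpha> / \<beta> ^ hdist x y) = real (card (?S (Suc m) - ?S m)) * (\<alpha> / \<beta> ^ Suc m)"
    using hdist_annulus[OF assms(2)] step(1) by simp
  also have "\<dots> \<le> real (N ^ Suc m) * (\<alpha> / \<beta> ^ Suc m)"
  proof (rule mult_right_mono)
    have "card (?S (Suc m) - ?S m) \<le> card (?S (Suc m))" by (rule card_mono[OF fin]) auto
    then show "real (card (?S (Suc m) - ?S m)) \<le> real (N ^ Suc m)"
      unfolding card_hball[OF N1 origin] of_nat_le_iff .
  qed (use \<alpha> \<beta> in simp)
  also have "\<dots> = \<alpha> * (N / \<beta>) ^ Suc m" by (simp add: power_divide)
  finally have last: "(\<Sum>y\<in>?S (Suc m) - ?S m. \<alpha> / \<beta> ^ hdist x y) \<le> \<alpha> * (N / \<beta>) ^ Suc m" .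
  have "(\<Sum>y\<in>?S (Suc m) - ?S n. \<alpha> / \<beta> ^ hdist x y)
      = (\<Sum>y\<in>?S m - ?S n. \<alpha> / \<beta> ^ hdist x y) + (\<Sum>y\<in>?S (Suc m) - ?S m. \<alpha> / \<beta> ^ hdist x y)"
    unfolding eq by (rule sum.union_disjoint) (use fin in auto)
  also have "\<dots> \<le> \<alpha> * (N / (\<beta> - N)) * ((N / \<beta>) ^ n - (N / \<beta>) ^ m) + \<alpha> * (N / \<beta>) ^ Suc m"
    using step.IH last by (rule add_mono)
  also have "\<dots> = \<alpha> * (N / (\<beta> - N)) * ((N / \<beta>) ^ n - (N / \<beta>) ^ Suc m)"
  proof -
    have "(N / (\<beta> - N)) * (r - (N / \<beta>) * r) = (N / \<beta>) * r" for r
      using assms(1) \<beta> by (simp add: divide_simps) (simp add: algebra_simps)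
    from this[of "(N / \<beta>) ^ m"]
    have "\<alpha> * ((N / (\<beta> - N)) * ((N / \<beta>) ^ m - (N / \<beta>) ^ Suc m)) = \<alpha> * (N / \<beta>) ^ Suc m"
      by simp
    then show ?thesis by (simp only: algebra_simps)
  qed
  finally show ?case .
qed

text \<open>The pairs through which \<open>C\<close> can be left towards the outside of the
  radius-\<open>n\<close> ball, cut off at radius \<open>M\<close> to keep the set finite for finite
  \<open>C\<close>.\<close>

definition escape_pairs :: "nat \<Rightarrow> nat \<Rightarrow> vertex set \<Rightarrow> vertex set set" where
  "escape_pairs n M C = (\<lambda>(x, y). {x, y}) ` (C \<times> (hball N M origin - hball N n origin))"

lemma escape_pairs_subset:
  assumes "C \<subseteq> hball N n origin" "n \<le> M"
  shows "escape_pairs n M C \<subseteq> ball_pairs M origin - ball_pairs n origin"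
proof -
  have "C \<subseteq> hball N M origin" using assms hball_mono by blast
  then show ?thesis
    using assms hball_subset_hlattice unfolding escape_pairs_def ball_pairs_def pairs_def by fast
qed

text \<open>Each vertex of \<open>C\<close> has outgoing rate of order
  \<open>(N / \<beta>) ^ n\<close>, which cancels the allowed number of vertices
  \<open>K * (\<beta> / N) ^ n\<close>. Hence the bound depends neither on \<open>n\<close> nor on
  \<open>M\<close>.\<close>

lemma prob_escape_pairs_closed:
  assumes "N < \<beta>" "C \<subseteq> hball N n origin" "n \<le> M" "real (card C) \<le> K * (\<beta> / N) ^ n"
  shows "exp (- (K * \<alpha> * (N / (\<beta> - N)))) \<le> prob {\<omega> \<in> space P. edges N \<omega> \<inter> escape_pairs n M C = {}}"
proof -
  let ?D = "escape_pairs n M C"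
  let ?A = "hball N M origin - hball N n origin"
  let ?c = "\<alpha> * (N / (\<beta> - N))"
  have c: "0 \<le> ?c" using \<alpha> assms(1) by simp
  have fin: "finite C" "finite ?A"
    using assms(2) finite_hball[OF N1 origin] finite_subset by blast+
  have D: "?D \<subseteq> pairs N" using escape_pairs_subset[OF assms(2,3)] by (auto simp: ball_pairs_def)
  have "(\<Sum>e\<in>?D. \<alpha> / \<beta> ^ pair_dist e) \<le> (\<Sum>p\<in>C \<times> ?A. \<alpha> / \<beta> ^ pair_dist (case p of (x, y) \<Rightarrow> {x, y}))"
    unfolding escape_pairs_def by (rule sum_image_le[unfolded o_def]) (use fin \<alpha> \<beta> in auto)
  also have "\<dots> = (\<Sum>x\<in>C. \<Sum>y\<in>?A. \<alpha> / \<beta> ^ hdist x y)"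
    by (simp add: sum.cartesian_product case_prod_unfold)
  also have "\<dots> \<le> (\<Sum>x\<in>C. ?c * (N / \<beta>) ^ n)"
  proof (rule sum_mono)
    fix x assume "x \<in> C"
    then have "(\<Sum>y\<in>?A. \<alpha> / \<beta> ^ hdist x y) \<le> ?c * ((N / \<beta>) ^ n - (N / \<beta>) ^ M)"
      using sum_rates_annulus_le assms by blast
    also have "\<dots> \<le> ?c * (N / \<beta>) ^ n"
      by (rule mult_left_mono) (use c \<beta> in simp_all)
    finally show "(\<Sum>y\<in>?A. \<alpha> / \<beta> ^ hdist x y) \<le> ?c * (N / \<beta>) ^ n" .
  qed
  also have "\<dots> = real (card C) * (?c * (N / \<beta>) ^ n)" by simp
  also have "\<dots> \<le> (K * (\<beta> / N) ^ n) * (?c * (N / \<beta>) ^ n)"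
    by (intro mult_right_mono[OF assms(4)] mult_nonneg_nonneg c) (use \<beta> in simp)
  also have "\<dots> = K * ?c * ((\<beta> / N) ^ n * (N / \<beta>) ^ n)" by (simp only: mult_ac)
  also have "(\<beta> / N) ^ n * (N / \<beta>) ^ n = 1"
    using N1 \<beta> by (simp add: power_mult_distrib[symmetric])
  finally have "(\<Sum>e\<in>?D. \<alpha> / \<beta> ^ pair_dist e) \<le> K * \<alpha> * (N / (\<beta> - N))" by simp
  moreover have "finite ?D" using fin by (simp add: escape_pairs_def)
  ultimately show ?thesis using prob_closed[OF _ D] by simp
qed

text \<open>An edge leading out of the level-\<open>n\<close> cluster would either stay in the
  radius-\<open>n\<close> ball, and then its endpoint already belongs to the cluster, or be an
  escape pair.\<close>

lemma ball_cluster_subset_if_no_escape: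
  assumes "edges N \<omega> \<inter> escape_pairs n M (ball_cluster N \<omega> n origin) = {}"
  shows "ball_cluster N \<omega> M origin \<subseteq> ball_cluster N \<omega> n origin"
  unfolding ball_cluster_alt[of _ M]
proof (rule component_closed)
  fix y z assume y: "y \<in> ball_cluster N \<omega> n origin" and e: "{y, z} \<in> edges N \<omega> \<inter> ball_pairs M origin"
  have "z \<in> hball N n origin"
  proof (rule ccontr)
    assume "z \<notin> hball N n origin"
    then have "{y, z} \<in> escape_pairs n M (ball_cluster N \<omega> n origin)"
      using e y unfolding escape_pairs_def ball_pairs_def by (auto intro!: image_eqI[of _ _ "(y, z)"])
    then show False using e assms by blast
  qed
  moreover have "y \<in> hball N n origin" using y ball_cluster_subset[OF origin] by blast
  ultimately have "{y, z} \<in> edges N \<omega> \<inter> ball_pairs n origin"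
    using e by (auto simp: ball_pairs_def)
  with y show "z \<in> ball_cluster N \<omega> n origin"
    unfolding ball_cluster_alt by (rule component_step)
qed simp

text \<open>The event of an infinite cluster is reached by a double limit: first \<open>n\<close>
  tends to infinity, giving \<open>escape_prob_lim m\<close>, and then \<open>m\<close> does, giving
  \<theta>.\<close>

definition escape_prob :: "nat \<Rightarrow> nat \<Rightarrow> real" where
  "escape_prob m n = prob {\<omega> \<in> space P. \<not> ball_cluster N \<omega> n origin \<subseteq> hball N m origin}"

definition escape_prob_lim :: "nat \<Rightarrow> real" where
  "escape_prob_lim m = prob {\<omega> \<in> space P. \<exists>n. \<not> ball_cluster N \<omega> n origin \<subseteq> hball N m origin}"

lemma event_leave_ball: "{\<omega> \<in> space P. \<not> ball_cluster N \<omega> n origin \<subseteq> hball N m origin} \<in> events"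
  by (rule event_ball_cluster[OF origin])

lemma escape_prob_tendsto: "(\<lambda>n. escape_prob m n) \<longlonglongrightarrow> escape_prob_lim m"
proof -
  let ?A = "\<lambda>n. {\<omega> \<in> space P. \<not> ball_cluster N \<omega> n origin \<subseteq> hball N m origin}"
  have "(\<lambda>n. prob (?A n)) \<longlonglongrightarrow> prob (\<Union>n. ?A n)"
  proof (rule finite_Lim_measure_incseq)
    show "range ?A \<subseteq> events" using event_leave_ball by blast
    show "incseq ?A" using ball_cluster_mono[of _ _ _ origin] unfolding incseq_def by blast
  qed
  moreover have "(\<Union>n. ?A n) = {\<omega> \<in> space P. \<exists>n. \<not> ball_cluster N \<omega> n origin \<subseteq> hball N m origin}" by blast
  ultimately show ?thesis by (simp add: escape_prob_def escape_prob_lim_def)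
qed

lemma event_escape: "{\<omega> \<in> space P. \<exists>n. \<not> ball_cluster N \<omega> n origin \<subseteq> hball N m origin} \<in> events"
proof -
  have "{\<omega> \<in> space P. \<exists>n. \<not> ball_cluster N \<omega> n origin \<subseteq> hball N m origin} =
      (\<Union>n. {\<omega> \<in> space P. \<not> ball_cluster N \<omega> n origin \<subseteq> hball N m origin})" by blast
  then show ?thesis using event_leave_ball by auto
qed

lemma escape_prob_lim_tendsto: "escape_prob_lim \<longlonglongrightarrow> \<theta> N \<alpha> \<beta>"
proof -
  let ?A = "\<lambda>m. {\<omega> \<in> space P. \<exists>n. \<not> ball_cluster N \<omega> n origin \<subseteq> hball N m origin}"
  have "(\<lambda>m. prob (?A m)) \<longlonglongrightarrow> prob (\<Inter>m. ?A m)"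
  proof (rule finite_Lim_measure_decseq)
    show "range ?A \<subseteq> events" using event_escape by blast
    show "decseq ?A" using hball_mono[of _ _ origin] unfolding decseq_def by blast
  qed
  moreover have "(\<Inter>m. ?A m) = {\<omega> \<in> space P. infinite (cluster N \<omega> origin)}"
    unfolding infinite_cluster_iff by blast
  ultimately show ?thesis by (simp add: escape_prob_lim_def[abs_def] \<theta>_def)
qed

lemma theta_le_escape_prob_lim: "\<theta> N \<alpha> \<beta> \<le> escape_prob_lim m"
  unfolding \<theta>_def escape_prob_lim_def
  by (rule finite_measure_mono[OF _ event_escape]) (auto simp: infinite_cluster_iff)

text \<open>A small cluster that has left \<open>hball N m origin\<close> is finite with conditional probability
  bounded below, but the probability of leaving this ball without being infinite tends to 0.\<close>

lemma prob_escape_small_le: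
  assumes "N < \<beta>" "m \<le> n"
  shows "exp (- (K * \<alpha> * (N / (\<beta> - N)))) *
      prob {\<omega> \<in> space P. \<not> ball_cluster N \<omega> n origin \<subseteq> hball N m origin \<and>
        real (card (ball_cluster N \<omega> n origin)) \<le> K * (\<beta> / N) ^ n}
    \<le> escape_prob_lim m - \<theta> N \<alpha> \<beta>"
proof -
  let ?q = "exp (- (K * \<alpha> * (N / (\<beta> - N))))"
  let ?G = "\<lambda>C. \<not> C \<subseteq> hball N m origin \<and> real (card C) \<le> K * (\<beta> / N) ^ n"
  let ?C = "\<lambda>\<omega>. ball_cluster N \<omega> n origin"
  let ?H = "\<lambda>m M. {\<omega> \<in> space P. \<not> ball_cluster N \<omega> M origin \<subseteq> hball N m origin}"
  let ?p = "prob {\<omega> \<in> space P. ?G (?C \<omega>)}"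
  have "?q * ?p \<le> escape_prob m M - escape_prob n M" if "n \<le> M" for M
  proof -
    let ?I = "ball_pairs n origin"
    let ?J = "ball_pairs M origin - ball_pairs n origin"
    let ?cl = "\<lambda>a. component a origin"
    have I: "finite ?I" "?I \<subseteq> pairs N" and J: "finite ?J" "?J \<subseteq> pairs N" and IJ: "?I \<inter> ?J = {}"
      using finite_ball_pairs[OF origin] ball_pairs_subset by auto
    \<comment> \<open>The state \<open>a\<close> of the inner edges fixes the level-\<open>n\<close>
      cluster \<open>?cl a\<close>; its escape pairs are then a known subset of \<open>?J\<close>,
      disjoint from the revealed edges.\<close>
    let ?R = "\<lambda>a b. ?G (?cl a) \<and> b \<inter> escape_pairs n M (?cl a) = {}"
    have "?q * ?p = (\<Sum>a\<in>Pow ?I. prob {\<omega> \<in> space P. edges N \<omega> \<inter> ?I = a} * (?q * of_bool (?G (?cl a))))"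
      using sum_prob_edges_Int_eq[OF I, of "\<lambda>a. ?G (?cl a)"]
      by (simp add: ball_cluster_alt sum_distrib_left mult_ac)
    also have "\<dots> \<le> (\<Sum>a\<in>Pow ?I. prob {\<omega> \<in> space P. edges N \<omega> \<inter> ?I = a} *
        prob {\<omega> \<in> space P. ?R a (edges N \<omega> \<inter> ?J)})"
    proof (intro sum_mono mult_left_mono)
      fix a assume "a \<in> Pow ?I"
      then have C: "?cl a \<subseteq> hball N n origin"
        using component_ball_subset[OF origin, of a n] by (simp add: Int_absorb2)
      then have "escape_pairs n M (?cl a) \<subseteq> ?J" using escape_pairs_subset that by simp
      then have eq: "edges N \<omega> \<inter> ?J \<inter> escape_pairs n M (?cl a) = edges N \<omega> \<inter> escape_pairs n M (?cl a)" for \<omega>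
        by blast
      show "?q * of_bool (?G (?cl a)) \<le> prob {\<omega> \<in> space P. ?R a (edges N \<omega> \<inter> ?J)}"
        using prob_escape_pairs_closed[OF assms(1) C that] unfolding eq by (cases "?G (?cl a)") auto
    qed simp
    also have "\<dots> = prob {\<omega> \<in> space P. ?R (edges N \<omega> \<inter> ?I) (edges N \<omega> \<inter> ?J)}"
      by (rule prob_edges_condition[OF I J IJ, symmetric])
    \<comment> \<open>Without escape edges the level-\<open>M\<close> cluster equals the
      level-\<open>n\<close> cluster, which has left the radius-\<open>m\<close> ball but is
      contained in the radius-\<open>n\<close> ball.\<close>
    also have "\<dots> \<le> prob (?H m M - ?H n M)"
    proof (rule finite_measure_mono)
      show "?H m M - ?H n M \<in> events" by (intro sets.Diff event_leave_ball)
      show "{\<omega> \<in> space P. ?R (edges N \<omega> \<inter> ?I) (edges N \<omega> \<inter> ?J)} \<subseteq> ?H m M - ?H n M"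
      proof
        fix \<omega> assume "\<omega> \<in> {\<omega> \<in> space P. ?R (edges N \<omega> \<inter> ?I) (edges N \<omega> \<inter> ?J)}"
        then have \<omega>: "\<omega> \<in> space P" and G: "?G (?C \<omega>)"
          and cl: "edges N \<omega> \<inter> ?J \<inter> escape_pairs n M (?C \<omega>) = {}"
          by (simp_all add: ball_cluster_alt)
        have "escape_pairs n M (?C \<omega>) \<subseteq> ?J"
          using escape_pairs_subset[OF ball_cluster_subset[OF origin] that] .
        then have "edges N \<omega> \<inter> escape_pairs n M (?C \<omega>) = {}" using cl by blast
        then have "ball_cluster N \<omega> M origin \<subseteq> ?C \<omega>" by (rule ball_cluster_subset_if_no_escape)
        moreover have "?C \<omega> \<subseteq> ball_cluster N \<omega> M origin" by (rule ball_cluster_mono[OF that])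
        moreover have "?C \<omega> \<subseteq> hball N n origin" by (rule ball_cluster_subset[OF origin])
        ultimately show "\<omega> \<in> ?H m M - ?H n M" using \<omega> G by blast
      qed
    qed
    \<comment> \<open>The events are nested since \<open>m \<le> n\<close>, so the difference has
      the difference of the probabilities.\<close>
    also have "\<dots> = escape_prob m M - escape_prob n M"
      unfolding escape_prob_def
      by (rule finite_measure_Diff)
        (use event_leave_ball hball_mono[OF assms(2), of origin] in blast)+
    finally show ?thesis .
  qed
  then have "eventually (\<lambda>M. ?q * ?p \<le> escape_prob m M - escape_prob n M) sequentially"
    by (rule eventually_mono[OF eventually_ge_at_top[of n]])
  then have "?q * ?p \<le> escape_prob_lim m - escape_prob_lim n"
    by (intro tendsto_lowerbound[OF tendsto_diff[OF escape_prob_tendsto escape_prob_tendsto]]) auto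
  then show ?thesis using theta_le_escape_prob_lim[of n] by linarith
qed

text \<open>If \<open>N < \<beta>\<close>, leaving a fixed radius-\<open>m\<close> ball by level
  \<open>n\<close> has probability nearly at least \<theta>, and \<open>prob_escape_small_le\<close>
  makes leaving it with a small cluster unlikely, uniformly in \<open>n \<ge> m\<close>. If
  \<open>\<beta> \<le> N\<close>, the threshold is the constant \<open>K\<close>, which an infinite
  cluster exceeds at some level.\<close>

lemma prob_ball_cluster_large:
  fixes K \<eta> :: real
  assumes "0 < \<eta>"
  shows "\<forall>\<^sub>F n in sequentially. \<theta> N \<alpha> \<beta> - \<eta> <
    prob {\<omega> \<in> space P. K * (max (real N) \<beta> / N) ^ n < real (card (ball_cluster N \<omega> n origin))}"
proof (cases "N < \<beta>")
  case True
  let ?q = "exp (- (K * \<alpha> * (N / (\<beta> - N))))"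
  let ?A = "\<lambda>n. {\<omega> \<in> space P. K * (\<beta> / N) ^ n < real (card (ball_cluster N \<omega> n origin))}"
  \<comment> \<open>The tolerance carries the factor \<open>?q\<close> because bounding the
    small-cluster event requires a division by \<open>?q\<close>.\<close>
  have "eventually (\<lambda>m. escape_prob_lim m < \<theta> N \<alpha> \<beta> + ?q * (\<eta> / 2)) sequentially"
    by (rule order_tendstoD[OF escape_prob_lim_tendsto]) (use assms in simp)
  then obtain m where m: "escape_prob_lim m < \<theta> N \<alpha> \<beta> + ?q * (\<eta> / 2)"
    by (auto simp: eventually_sequentially)
  have "\<theta> N \<alpha> \<beta> - \<eta> / 2 < escape_prob_lim m"
    using theta_le_escape_prob_lim[of m] assms by linarith
  then have "eventually (\<lambda>n. \<theta> N \<alpha> \<beta> - \<eta> / 2 < escape_prob m n) sequentially"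
    by (rule order_tendstoD[OF escape_prob_tendsto])
  moreover have "eventually (\<lambda>n. n \<ge> m) sequentially" by (rule eventually_ge_at_top)
  ultimately have "eventually (\<lambda>n. \<theta> N \<alpha> \<beta> - \<eta> < prob (?A n)) sequentially"
  proof eventually_elim
    case (elim n)
    let ?B = "{\<omega> \<in> space P. \<not> ball_cluster N \<omega> n origin \<subseteq> hball N m origin \<and>
        real (card (ball_cluster N \<omega> n origin)) \<le> K * (\<beta> / N) ^ n}"
    have "?q * prob ?B \<le> ?q * (\<eta> / 2)"
      using prob_escape_small_le[OF True elim(2), of K] m by linarith
    then have B: "prob ?B \<le> \<eta> / 2" by simp
    have ev: "?A n \<in> events" "?B \<in> events"
      by (rule event_ball_cluster[OF origin])+
    have "escape_prob m n \<le> prob (?A n \<union> ?B)"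
      unfolding escape_prob_def by (rule finite_measure_mono) (use ev in auto)
    also have "\<dots> \<le> prob (?A n) + prob ?B" by (rule measure_Un_le[OF ev])
    finally show ?case using B elim(1) by linarith
  qed
  then show ?thesis using True by (simp add: max_def)
next
  case False
  let ?A = "\<lambda>n. {\<omega> \<in> space P. K < real (card (ball_cluster N \<omega> n origin))}"
  have ev: "?A n \<in> events" for n by (rule event_ball_cluster[OF origin])
  have "(\<lambda>n. prob (?A n)) \<longlonglongrightarrow> prob (\<Union>n. ?A n)"
  proof (rule finite_Lim_measure_incseq)
    show "range ?A \<subseteq> events" using ev by blast
    have "real (card (ball_cluster N \<omega> n origin)) \<le> real (card (ball_cluster N \<omega> n' origin))"
      if "n \<le> n'" for \<omega> n n'
      by (intro of_nat_mono card_mono[OF finite_ball_cluster[OF origin] ball_cluster_mono[OF that]])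
    then show "incseq ?A" unfolding incseq_def by (auto intro: order_less_le_trans)
  qed
  moreover have "\<theta> N \<alpha> \<beta> \<le> prob (\<Union>n. ?A n)"
    unfolding \<theta>_def
  proof (rule finite_measure_mono)
    show "(\<Union>n. ?A n) \<in> events" using ev by blast
    show "{\<omega> \<in> space P. infinite (cluster N \<omega> origin)} \<subseteq> (\<Union>n. ?A n)"
    proof
      fix \<omega> assume \<omega>: "\<omega> \<in> {\<omega> \<in> space P. infinite (cluster N \<omega> origin)}"
      \<comment> \<open>\<open>nat\<close> sends a negative ceiling to 0, and the added 1 makes
        \<open>K < card F\<close> strict.\<close>
      then obtain F where F: "F \<subseteq> cluster N \<omega> origin" "finite F" "card F = nat \<lceil>K\<rceil> + 1"
        using infinite_arbitrarily_large[of "cluster N \<omega> origin"] by blast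
      have "\<exists>n. F \<subseteq> ball_cluster N \<omega> n origin"
      proof -
        obtain g where g: "\<And>x. x \<in> F \<Longrightarrow> x \<in> ball_cluster N \<omega> (g x) origin"
          using F(1) unfolding cluster_eq_UN_ball_cluster by (metis UN_E subsetD)
        have "x \<in> ball_cluster N \<omega> (Max (g ` F)) origin" if "x \<in> F" for x
        proof -
          have "g x \<le> Max (g ` F)" using F(2) that by simp
          then show ?thesis using ball_cluster_mono g[OF that] by blast
        qed
        then show ?thesis by blast
      qed
      then obtain n where "F \<subseteq> ball_cluster N \<omega> n origin" by blast
      then have "card F \<le> card (ball_cluster N \<omega> n origin)"
        by (rule card_mono[OF finite_ball_cluster[OF origin]])
      then have "K < real (card (ball_cluster N \<omega> n origin))" using F(3) by linarith
      then show "\<omega> \<in> (\<Union>n. ?A n)" using \<omega> by blast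
    qed
  qed
  then have "\<theta> N \<alpha> \<beta> - \<eta> < prob (\<Union>n. ?A n)" using assms by linarith
  ultimately have "\<forall>\<^sub>F n in sequentially. \<theta> N \<alpha> \<beta> - \<eta> < prob (?A n)"
    by (rule order_tendstoD)
  then show ?thesis using False N1 by (simp add: max_def)
qed

text \<open>If \<open>\<beta> \<ge> N^2\<close>, the threshold with \<open>K = 1\<close> is at least
  the volume \<open>N ^ n\<close> of the ball, so no cluster exceeds it. Yet
  \<open>prob_ball_cluster_large\<close> with \<open>\<eta> = \<theta>\<close> gives this event a
  positive probability for large \<open>n\<close>.\<close>

lemma beta_less_if_theta_pos:
  assumes "\<theta> N \<alpha> \<beta> > 0"
  shows "\<beta> < real N ^ 2"
proof (rule ccontr)
  assume "\<not> \<beta> < real N ^ 2"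
  then have "real N * real N \<le> max (real N) \<beta>" by (simp add: power2_eq_square)
  then have s: "real N \<le> max (real N) \<beta> / N" using N1 by (simp add: field_simps)
  have False if "\<omega> \<in> space P" "(max (real N) \<beta> / N) ^ n < real (card (ball_cluster N \<omega> n origin))" for \<omega> n
  proof -
    have "card (ball_cluster N \<omega> n origin) \<le> N ^ n"
      using card_mono[OF finite_hball[OF N1 origin] ball_cluster_subset[OF origin]]
      by (simp add: card_hball[OF N1 origin])
    then have "real (card (ball_cluster N \<omega> n origin)) \<le> real N ^ n"
      by (metis of_nat_le_iff of_nat_power)
    also have "\<dots> \<le> (max (real N) \<beta> / N) ^ n" by (rule power_mono[OF s]) simp
    finally show False using that by simp
  qed
  then have "{\<omega> \<in> space P. 1 * (max (real N) \<beta> / N) ^ n < real (card (ball_cluster N \<omega> n origin))} = {}" for n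
    by auto
  then have "prob {\<omega> \<in> space P. 1 * (max (real N) \<beta> / N) ^ n < real (card (ball_cluster N \<omega> n origin))} = 0" for n
    by (simp only: measure_empty)
  then show False
    using prob_ball_cluster_large[of "\<theta> N \<alpha> \<beta>" 1] assms by simp
qed

text \<open>If \<open>\<alpha> = 0\<close>, every finite set of edges is absent with probability 1,
  so the origin almost surely never leaves its ball of radius 0.\<close>

lemma alpha_pos_if_theta_pos:
  assumes "\<theta> N \<alpha> \<beta> > 0"
  shows "0 < \<alpha>"
proof (rule ccontr)
  assume "\<not> 0 < \<alpha>"
  then have 0: "\<alpha> = 0" using \<alpha> by simp
  have "escape_prob 0 n = 0" for n
  proof -
    let ?E = "{\<omega> \<in> space P. edges N \<omega> \<inter> ball_pairs n origin = {}}"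
    have ev: "?E \<in> events" by (rule event_edges_Int[OF finite_ball_pairs[OF origin]])
    have "prob ?E = 1"
      using prob_closed[OF finite_ball_pairs[OF origin] ball_pairs_subset] by (simp add: 0)
    have "component {} origin \<subseteq> {origin}" by (rule component_closed) auto
    then have "escape_prob 0 n \<le> prob (space P - ?E)"
      unfolding escape_prob_def ball_cluster_alt
      by (intro finite_measure_mono sets.compl_sets ev) (use hball_self[OF origin] in auto)
    then have "escape_prob 0 n \<le> 0" using prob_compl[OF ev] \<open>prob ?E = 1\<close> by simp
    then show ?thesis by (simp add: escape_prob_def measure_le_0_iff)
  qed
  then have "escape_prob_lim 0 = 0" using escape_prob_tendsto[of 0] by (simp add: LIMSEQ_const_iff)
  then show False using theta_le_escape_prob_lim[of 0] assms by simp
qed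

subsection \<open>Merging of large clusters\<close>

text \<open>Deleting all edges that are not inside the radius-\<open>k\<close> ball keeps these
  clusters, so \<open>Q\<close> can be evaluated on a configuration given by a finite edge
  set.\<close>

lemma event_if_determined_by_ball:
  assumes Q: "\<And>\<omega> \<omega>'. (\<And>m y. m \<le> k \<Longrightarrow> y \<in> hball N k origin \<Longrightarrow>
    ball_cluster N \<omega> m y = ball_cluster N \<omega>' m y) \<Longrightarrow> Q \<omega> \<longleftrightarrow> Q \<omega>'"
  shows "{\<omega> \<in> space P. Q \<omega>} \<in> events"
proof -
  let ?r = "\<lambda>a e. e \<in> a"
  have "ball_cluster N \<omega> m y = ball_cluster N (?r (edges N \<omega> \<inter> ball_pairs k origin)) m y"
    if "m \<le> k" "y \<in> hball N k origin" for \<omega> m y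
  proof -
    have "ball_pairs m y \<subseteq> ball_pairs k origin"
      using ball_pairs_mono[OF that(1), of y] hball_eq_hball[OF origin that(2)]
      by (simp add: ball_pairs_def)
    then have "edges N (?r (edges N \<omega> \<inter> ball_pairs k origin)) \<inter> ball_pairs m y = edges N \<omega> \<inter> ball_pairs m y"
      unfolding edges_def by blast
    then show ?thesis by (simp only: ball_cluster_alt)
  qed
  then have "Q \<omega> \<longleftrightarrow> Q (?r (edges N \<omega> \<inter> ball_pairs k origin))" for \<omega>
    by (rule Q)
  then show ?thesis
    using event_edges_Int[OF finite_ball_pairs[OF origin], of "\<lambda>a. Q (?r a)" k] by simp
qed

lemma event_large_cluster:
  "{\<omega> \<in> space P. \<exists>y\<in>hball N k origin. t < real (card (ball_cluster N \<omega> k y))} \<in> events"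
  by (rule event_if_determined_by_ball[of k]) simp

section \<open>Density of the vertices in large clusters\<close>

definition vertices_in_large_clusters :: "nat \<Rightarrow> nat \<Rightarrow> real \<Rightarrow> config \<Rightarrow> vertex set" where
  "vertices_in_large_clusters n k L \<omega> =
    {x \<in> hball N k origin. L < real (card (ball_cluster N \<omega> n x))}"

lemma finite_vertices_in_large_clusters [simp]: "finite (vertices_in_large_clusters n k L \<omega>)"
  unfolding vertices_in_large_clusters_def using finite_hball[OF N1 origin] by simp

text \<open>Two balls of equal radius are equal or disjoint; in the second case their clusters
  depend on disjoint sets of edges.\<close>

lemma prob_large_clusters_indep:
  assumes "x \<in> hlattice N" "y \<in> hlattice N" "y \<notin> hball N n x"
  shows "prob ({\<omega> \<in> space P. Q (ball_cluster N \<omega> n x)} \<inter> {\<omega> \<in> space P. R (ball_cluster N \<omega> n y)}) =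
    prob {\<omega> \<in> space P. Q (ball_cluster N \<omega> n x)} * prob {\<omega> \<in> space P. R (ball_cluster N \<omega> n y)}"
proof -
  have "ball_pairs n x \<inter> ball_pairs n y = {}"
    using hball_disjoint[OF assms] by (force simp: ball_pairs_def pairs_def)
  moreover have "{\<omega> \<in> space P. Q (ball_cluster N \<omega> n x)} \<inter> {\<omega> \<in> space P. R (ball_cluster N \<omega> n y)} =
      {\<omega> \<in> space P. Q (ball_cluster N \<omega> n x) \<and> R (ball_cluster N \<omega> n y)}" by blast
  ultimately show ?thesis
    using prob_edges_indep[OF finite_ball_pairs[OF assms(1)] ball_pairs_subset
      finite_ball_pairs[OF assms(2)] ball_pairs_subset,
      of n n "\<lambda>a. Q (component a x)" "\<lambda>a. R (component a y)"]
    by (simp add: ball_cluster_alt)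
qed

text \<open>Chebyshev's inequality for the number of such vertices, whose mean is
  \<open>p * N ^ k\<close>. Only vertices in a common radius-\<open>n\<close> ball are correlated,
  so the variance is at most \<open>N ^ k * N ^ n\<close>.\<close>

lemma prob_few_vertices_in_large_clusters:
  fixes t p L :: real and n :: nat
  assumes "0 < t"
  defines "p \<equiv> prob {\<omega> \<in> space P. L < real (card (ball_cluster N \<omega> n origin))}"
  shows "prob {\<omega> \<in> space P. real (card (vertices_in_large_clusters n k L \<omega>)) \<le> (p - t) * N ^ k}
    \<le> N ^ n / (t\<^sup>2 * N ^ k)"
proof -
  let ?B = "hball N k origin"
  let ?W = "\<lambda>\<omega>. real (card (vertices_in_large_clusters n k L \<omega>))"
  define A where "A x = {\<omega> \<in> space P. L < real (card (ball_cluster N \<omega> n x))}" for x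
  define f where "f \<omega> = (\<Sum>x\<in>?B. indicator (A x) \<omega> :: real)" for \<omega>
  have finB: "finite ?B" and cardB: "card ?B = N ^ k"
    using finite_hball card_hball N1 by auto
  have B: "x \<in> hlattice N" if "x \<in> ?B" for x using that hball_subset_hlattice by blast
  have evA [measurable]: "A x \<in> events" if "x \<in> ?B" for x
    unfolding A_def by (rule event_ball_cluster[OF B[OF that]])
  have pA: "prob (A x) = p" if "x \<in> ?B" for x
    using prob_card_ball_cluster[OF B[OF that], of "\<lambda>c. L < real c"] by (simp add: A_def p_def)
  have f: "f \<omega> = ?W \<omega>" if "\<omega> \<in> space P" for \<omega>
  proof -
    have "f \<omega> = (\<Sum>x\<in>?B. of_bool (L < real (card (ball_cluster N \<omega> n x))))"
      unfolding f_def by (rule sum.cong) (use that in \<open>auto simp: A_def indicator_def\<close>)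
    also have "\<dots> = ?W \<omega>"
      using finB by (simp add: vertices_in_large_clusters_def Int_def)
    finally show ?thesis .
  qed
  have f_borel: "f \<in> borel_measurable P"
    unfolding f_def by (intro borel_measurable_sum borel_measurable_indicator evA)
  have f_sq: "(f \<omega>)\<^sup>2 = (\<Sum>x\<in>?B. \<Sum>y\<in>?B. indicator (A x \<inter> A y) \<omega>)" for \<omega>
    by (simp add: f_def power2_eq_square sum_product indicator_inter_arith)
  have int_ind: "integrable P (indicator (A x \<inter> A y) :: _ \<Rightarrow> real)" if "x \<in> ?B" "y \<in> ?B" for x y
    using evA that by (intro integrable_real_indicator sets.Int) (auto simp: emeasure_eq_measure)
  have int_sq: "integrable P (\<lambda>\<omega>. (f \<omega>)\<^sup>2)"
    unfolding f_sq by (intro Bochner_Integration.integrable_sum int_ind)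
  have int_f: "integrable P f"
    unfolding f_def using int_ind[of x x for x] by (intro Bochner_Integration.integrable_sum) simp
  have Ef: "expectation f = p * N ^ k"
  proof -
    have "expectation f = (\<Sum>x\<in>?B. expectation (indicator (A x)))"
      unfolding f_def using int_ind[of x x for x] by (intro Bochner_Integration.integral_sum) simp
    also have "\<dots> = (\<Sum>x\<in>?B. p)"
      by (rule sum.cong) (use pA evA in \<open>auto simp: A_def\<close>)
    finally show ?thesis by (simp add: cardB)
  qed
  \<comment> \<open>In different radius-\<open>n\<close> balls the probability factors; in a common
    ball the trivial bound 1 suffices, as each \<open>x\<close> has only \<open>N ^ n\<close>
    partners there.\<close>
  have cov: "prob (A x \<inter> A y) \<le> p\<^sup>2 + of_bool (y \<in> hball N n x)" if "x \<in> ?B" "y \<in> ?B" for x y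
  proof (cases "y \<in> hball N n x")
    case True
    then show ?thesis using prob_le_1[of "A x \<inter> A y"] by (simp add: add_increasing)
  next
    case False
    then show ?thesis
      using prob_large_clusters_indep[OF B[OF that(1)] B[OF that(2)] False,
          of "\<lambda>C. L < real (card C)" "\<lambda>C. L < real (card C)"] pA that
      by (simp add: A_def power2_eq_square)
  qed
  have "expectation (\<lambda>\<omega>. (f \<omega>)\<^sup>2) = (\<Sum>x\<in>?B. \<Sum>y\<in>?B. expectation (indicator (A x \<inter> A y)))"
    unfolding f_sq
  proof (subst Bochner_Integration.integral_sum)
    show "integrable P (\<lambda>\<omega>. \<Sum>y\<in>?B. indicator (A x \<inter> A y) \<omega> :: real)" if "x \<in> ?B" for x
      by (intro Bochner_Integration.integrable_sum int_ind that)
  qed (intro sum.cong refl Bochner_Integration.integral_sum int_ind)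
  also have "\<dots> = (\<Sum>x\<in>?B. \<Sum>y\<in>?B. prob (A x \<inter> A y))"
    by (intro sum.cong refl) (use evA in \<open>auto simp: A_def\<close>)
  also have "\<dots> \<le> (\<Sum>x\<in>?B. \<Sum>y\<in>?B. p\<^sup>2 + of_bool (y \<in> hball N n x))"
    by (intro sum_mono cov)
  also have "\<dots> = (p * N ^ k)\<^sup>2 + (\<Sum>x\<in>?B. real (card (?B \<inter> hball N n x)))"
    using finB by (simp add: sum.distrib cardB power2_eq_square Int_def)
  also have "(\<Sum>x\<in>?B. real (card (?B \<inter> hball N n x))) \<le> (\<Sum>x\<in>?B. real (N ^ n))"
    by (intro sum_mono of_nat_mono, subst card_hball[OF N1 B, symmetric], assumption)
      (intro card_mono finite_hball[OF N1 B] Int_lower2)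
  finally have "expectation (\<lambda>\<omega>. (f \<omega>)\<^sup>2) \<le> (p * N ^ k)\<^sup>2 + N ^ k * N ^ n"
    by (simp add: cardB)
  then have var: "variance f \<le> N ^ k * N ^ n"
    using variance_eq[OF int_f int_sq] Ef by simp
  have tN: "0 < t * N ^ k" using assms(1) N1 by simp
  have "prob {\<omega> \<in> space P. ?W \<omega> \<le> (p - t) * N ^ k} \<le> prob {\<omega> \<in> space P. t * N ^ k \<le> \<bar>f \<omega> - expectation f\<bar>}"
  proof (rule finite_measure_mono)
    show "{\<omega> \<in> space P. t * N ^ k \<le> \<bar>f \<omega> - expectation f\<bar>} \<in> events"
      using f_borel by measurable
    show "{\<omega> \<in> space P. ?W \<omega> \<le> (p - t) * N ^ k} \<subseteq> {\<omega> \<in> space P. t * N ^ k \<le> \<bar>f \<omega> - expectation f\<bar>}"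
      using f Ef by (auto simp: algebra_simps)
  qed
  also have "\<dots> \<le> variance f / (t * N ^ k)\<^sup>2"
    by (rule Chebyshev_inequality[OF f_borel int_sq tN])
  also have "\<dots> \<le> (N ^ k * N ^ n) / (t * N ^ k)\<^sup>2"
    using var by (rule divide_right_mono) simp
  also have "\<dots> = N ^ n / (t\<^sup>2 * N ^ k)"
    using assms(1) N1 by (simp add: power2_eq_square)
  finally show ?thesis .
qed

text \<open>Pairs within one radius-\<open>n\<close> ball are left out, so these edges are
  independent of the level-\<open>n\<close> clusters from which the sets \<open>A\<close> and
  \<open>A'\<close> will be built.\<close>

definition cross_pairs :: "nat \<Rightarrow> vertex set \<Rightarrow> vertex set \<Rightarrow> vertex set set" where
  "cross_pairs n A A' = (\<lambda>(x, y). {x, y}) ` {(x, y) \<in> A \<times> A'. y \<notin> hball N n x}"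

lemma cross_pairs_subset:
  assumes "A \<subseteq> hball N k origin" "A' \<subseteq> hball N k origin"
  shows "cross_pairs n A A' \<subseteq> ball_pairs k origin"
proof
  fix e assume "e \<in> cross_pairs n A A'"
  then obtain x y where e: "e = {x, y}" "x \<in> A" "y \<in> A'" "y \<notin> hball N n x"
    by (auto simp: cross_pairs_def)
  have "x \<in> hball N k origin" "y \<in> hball N k origin" using e assms by auto
  moreover from this have "x \<in> hlattice N" "y \<in> hlattice N" using hball_subset_hlattice by auto
  moreover from this have "x \<noteq> y" using e(4) hball_self by auto
  ultimately show "e \<in> ball_pairs k origin" unfolding ball_pairs_def pairs_def e(1) by blast
qed

lemma cross_pairs_disjoint:
  assumes "z \<in> hlattice N"
  shows "cross_pairs n A A' \<inter> ball_pairs n z = {}"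
proof -
  have False if "e \<in> cross_pairs n A A'" "e \<in> ball_pairs n z" for e
  proof -
    obtain x y where e: "e = {x, y}" "y \<notin> hball N n x" using \<open>e \<in> cross_pairs n A A'\<close> by (auto simp: cross_pairs_def)
    then have "x \<in> hball N n z" "y \<in> hball N n z" using \<open>e \<in> ball_pairs n z\<close> by (auto simp: ball_pairs_def)
    then show False using hball_eq_hball[OF assms, of x] e(2) by simp
  qed
  then show ?thesis by blast
qed

text \<open>Of the at least \<open>u * v\<close> pairs between the sets, at most
  \<open>N ^ k * N ^ n\<close> lie in a common radius-\<open>n\<close> ball. Each remaining pair has
  distance at most \<open>k\<close>, hence rate at least
  \<open>\<alpha> / max N \<beta> ^ k\<close>.\<close>

lemma prob_cross_pairs_closed:
  fixes u v :: real
  assumes A: "A \<subseteq> hball N k origin" "A' \<subseteq> hball N k origin" "A \<inter> A' = {}"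
    and u: "0 \<le> u" "u \<le> card A" and v: "0 \<le> v" "v \<le> card A'"
  shows "prob {\<omega> \<in> space P. edges N \<omega> \<inter> cross_pairs n A A' = {}}
    \<le> exp (- ((u * v - N ^ k * N ^ n) * (\<alpha> / max (real N) \<beta> ^ k)))"
proof -
  let ?B = "hball N k origin"
  let ?S = "{(x, y) \<in> A \<times> A'. y \<notin> hball N n x}"
  let ?c = "\<alpha> / max (real N) \<beta> ^ k"
  have lat: "x \<in> hlattice N" if "x \<in> ?B" for x using that hball_subset_hlattice by blast
  have finB: "finite ?B" by (rule finite_hball[OF N1 origin])
  have fin: "finite A" "finite A'" using A finB by (auto intro: finite_subset)
  have finS: "finite ?S" by (rule finite_subset[of _ "A \<times> A'"]) (use fin in auto)
  have "A \<times> A' \<subseteq> ?S \<union> Sigma ?B (hball N n)" using A by auto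
  moreover have finSig: "finite (Sigma ?B (hball N n))"
    using finB finite_hball[OF N1 lat] by (intro finite_SigmaI)
  ultimately have "card (A \<times> A') \<le> card (?S \<union> Sigma ?B (hball N n))"
    using finS by (intro card_mono) auto
  also have "\<dots> \<le> card ?S + card (Sigma ?B (hball N n))" by (rule card_Un_le)
  also have "card (Sigma ?B (hball N n)) = (\<Sum>x\<in>?B. card (hball N n x))"
    using finB finite_hball[OF N1 lat] by (intro card_SigmaI) auto
  also have "\<dots> = (\<Sum>x\<in>?B. N ^ n)" by (rule sum.cong[OF refl]) (rule card_hball[OF N1 lat])
  also have "\<dots> = N ^ k * N ^ n" using card_hball[OF N1 origin] by simp
  finally have "card A * card A' \<le> card ?S + N ^ k * N ^ n" by (simp add: card_cartesian_product)
  then have "real (card A * card A') \<le> real (card ?S + N ^ k * N ^ n)" by (simp only: of_nat_le_iff)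
  then have "real (card A) * real (card A') \<le> real (card ?S) + N ^ k * N ^ n" by simp
  moreover have "u * v \<le> real (card A) * real (card A')" using u v by (intro mult_mono) auto
  ultimately have S: "u * v - N ^ k * N ^ n \<le> real (card ?S)" by linarith
  have sub: "cross_pairs n A A' \<subseteq> ball_pairs k origin" by (rule cross_pairs_subset[OF A(1,2)])
  have inj: "inj_on (\<lambda>(x, y). {x, y}) ?S"
    using A(3) by (auto simp: inj_on_def doubleton_eq_iff)
  have c: "?c \<le> \<alpha> / \<beta> ^ pair_dist e" if e_cross: "e \<in> cross_pairs n A A'" for e
  proof -
    obtain x y where "e = {x, y}" "x \<in> A" "y \<in> A'"
      using e_cross by (auto simp: cross_pairs_def)
    then have e: "e = {x, y}" "x \<in> ?B" "y \<in> ?B" using A by auto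
    have "y \<in> hball N k x" using e hball_eq_hball[OF origin e(2)] by simp
    then have "hdist x y \<le> k" by (simp add: hball_def)
    \<comment> \<open>Passing to \<open>max N \<beta>\<close>, which is at least 1, makes the powers
      increase with the distance even when \<open>\<beta> < 1\<close>.\<close>
    have "\<beta> ^ hdist x y \<le> max (real N) \<beta> ^ hdist x y" by (rule power_mono) (use \<beta> in auto)
    also have "\<dots> \<le> max (real N) \<beta> ^ k"
      by (rule power_increasing[OF \<open>hdist x y \<le> k\<close>]) (use N1 in auto)
    finally show ?thesis unfolding e(1) using \<alpha> \<beta> by (simp add: frac_le)
  qed
  have "(u * v - N ^ k * N ^ n) * ?c \<le> real (card ?S) * ?c"
    by (rule mult_right_mono[OF S]) (use \<alpha> \<beta> in simp)
  also have "\<dots> = (\<Sum>e\<in>cross_pairs n A A'. ?c)"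
    using card_image[OF inj] by (simp add: cross_pairs_def)
  also have "\<dots> \<le> (\<Sum>e\<in>cross_pairs n A A'. \<alpha> / \<beta> ^ pair_dist e)" by (rule sum_mono[OF c])
  finally have "(u * v - N ^ k * N ^ n) * ?c \<le> (\<Sum>e\<in>cross_pairs n A A'. \<alpha> / \<beta> ^ pair_dist e)" .
  moreover have "finite (cross_pairs n A A')" using finS by (simp add: cross_pairs_def)
  ultimately show ?thesis
    using prob_closed[OF _ order_trans[OF sub ball_pairs_subset]] by simp
qed

text \<open>Group the vertices by their level-\<open>k\<close> cluster. Each class has size at most
  \<open>T\<close>, so some union of classes is balanced. An edge across the cut would join two
  distinct level-\<open>k\<close> clusters, and level-\<open>n\<close> clusters are never divided
  because they refine the level-\<open>k\<close> ones.\<close>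

lemma exists_cut:
  assumes "n \<le> k" "0 \<le> T"
    and W: "T < real (card (vertices_in_large_clusters n k L \<omega>))"
    and small: "\<forall>y\<in>hball N k origin. real (card (ball_cluster N \<omega> k y)) \<le> T"
  shows "\<exists>\<S>\<subseteq>ball_cluster N \<omega> n ` vertices_in_large_clusters n k L \<omega>.
    \<Union>\<S> \<subseteq> vertices_in_large_clusters n k L \<omega> \<and> T / 2 \<le> real (card (\<Union>\<S>)) \<and> real (card (\<Union>\<S>)) \<le> T \<and>
    edges N \<omega> \<inter> cross_pairs n (\<Union>\<S>) (vertices_in_large_clusters n k L \<omega> - \<Union>\<S>) = {}"
proof -
  let ?W = "vertices_in_large_clusters n k L \<omega>"
  let ?C = "ball_cluster N \<omega> k"
  have WB: "?W \<subseteq> hball N k origin" by (auto simp: vertices_in_large_clusters_def)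
  have lat: "x \<in> hlattice N" if "x \<in> ?W" for x using WB that hball_subset_hlattice by blast
  have "real (card {x \<in> ?W. ?C x = c}) \<le> T" for c
  proof (cases "{x \<in> ?W. ?C x = c} = {}")
    case False
    then obtain x where x: "x \<in> ?W" "?C x = c" by blast
    have "{x \<in> ?W. ?C x = c} \<subseteq> c" using ball_cluster_self by blast
    then have "card {x \<in> ?W. ?C x = c} \<le> card c"
      using finite_ball_cluster[OF lat[OF x(1)]] x(2) by (intro card_mono) auto
    moreover have "real (card c) \<le> T" using small x WB by blast
    ultimately show ?thesis by linarith
  next
    case True
    show ?thesis unfolding True using assms(2) by simp
  qed
  from exists_balanced_class_union[OF finite_vertices_in_large_clusters assms(2) this W]
  obtain S where S: "T / 2 \<le> real (card {x \<in> ?W. ?C x \<in> S})" "real (card {x \<in> ?W. ?C x \<in> S}) \<le> T" by blast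
  let ?A = "{x \<in> ?W. ?C x \<in> S}"
  \<comment> \<open>All vertices of a level-\<open>n\<close> cluster share their
    level-\<open>n\<close> and level-\<open>k\<close> clusters, so \<open>?A\<close> contains it
    whole.\<close>
  have cl: "ball_cluster N \<omega> n x \<subseteq> ?A" if x: "x \<in> ?A" for x
  proof
    fix y assume y: "y \<in> ball_cluster N \<omega> n x"
    have xl: "x \<in> hlattice N" using x lat by blast
    have "?C y = ?C x" using ball_cluster_eq[OF xl] ball_cluster_mono[OF assms(1)] y by blast
    moreover have "ball_cluster N \<omega> n y = ball_cluster N \<omega> n x" by (rule ball_cluster_eq[OF xl y])
    moreover have "y \<in> hball N k origin"
    proof -
      have "y \<in> hball N k x" using ball_cluster_subset[OF xl] hball_mono[OF assms(1)] y by blast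
      then show ?thesis using hball_eq_hball[OF origin, of x k] x WB by blast
    qed
    ultimately show "y \<in> ?A" using x by (simp add: vertices_in_large_clusters_def)
  qed
  have U: "\<Union>(ball_cluster N \<omega> n ` ?A) = ?A"
    using cl ball_cluster_self by blast
  have "False" if e: "e \<in> edges N \<omega>" "e \<in> cross_pairs n ?A (?W - ?A)" for e
  proof -
    obtain x y where xy: "e = {x, y}" "x \<in> ?A" "y \<in> ?W - ?A"
      using e(2) by (auto simp: cross_pairs_def)
    have "x \<in> hball N k origin" "y \<in> hball N k origin" using xy WB by auto
    then have "{x, y} \<in> edges N \<omega> \<inter> ball_pairs k x"
      using e(1) xy(1) hball_eq_hball[OF origin, of x k] by (simp add: ball_pairs_def edges_def)
    then have "y \<in> ?C x" unfolding ball_cluster_alt by (intro component_step[OF component_refl])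
    then have "?C y = ?C x" using ball_cluster_eq lat xy by blast
    then show False using xy by auto
  qed
  then have "edges N \<omega> \<inter> cross_pairs n ?A (?W - ?A) = {}" by blast
  then show ?thesis
    by (intro exI[of _ "ball_cluster N \<omega> n ` ?A"] conjI) (use S U in auto)
qed

text \<open>Distinct level-\<open>n\<close> clusters are disjoint, each has more than
  \<open>L\<close> vertices, and all are packed into a ball of volume \<open>N ^ k\<close>.\<close>

lemma card_large_cluster_family_le:
  assumes "0 < L" "n \<le> k"
  shows "real (card (ball_cluster N \<omega> n ` vertices_in_large_clusters n k L \<omega>)) \<le> N ^ k / L"
proof -
  let ?W = "vertices_in_large_clusters n k L \<omega>"
  have W: "x \<in> hlattice N" "hball N n x \<subseteq> hball N k origin" if "x \<in> ?W" for x
  proof -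
    have x: "x \<in> hball N k origin" using that by (simp add: vertices_in_large_clusters_def)
    then show "x \<in> hlattice N" using hball_subset_hlattice by blast
    show "hball N n x \<subseteq> hball N k origin"
      using hball_mono[OF assms(2), of x] hball_eq_hball[OF origin x] by simp
  qed
  have "L * real (card (ball_cluster N \<omega> n ` ?W)) \<le> real (card (hball N k origin))"
  proof (rule card_disjoint_large_le[OF finite_hball[OF N1 origin]])
    fix C assume "C \<in> ball_cluster N \<omega> n ` ?W"
    then obtain x where x: "x \<in> ?W" "C = ball_cluster N \<omega> n x" by blast
    show "C \<subseteq> hball N k origin" using ball_cluster_subset[OF W(1)[OF x(1)]] W(2)[OF x(1)] x(2) by blast
    show "L \<le> real (card C)" using x by (simp add: vertices_in_large_clusters_def)
  next
    have "ball_cluster N \<omega> n x = ball_cluster N \<omega> n y"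
      if "x \<in> ?W" "y \<in> ?W" "z \<in> ball_cluster N \<omega> n x" "z \<in> ball_cluster N \<omega> n y" for x y z
      using ball_cluster_eq[OF W(1)[OF that(1)] that(3)] ball_cluster_eq[OF W(1)[OF that(2)] that(4)] by simp
    then show "disjoint (ball_cluster N \<omega> n ` ?W)"
      by (auto simp: pairwise_def disjnt_def)
  qed
  then show ?thesis using assms card_hball[OF N1 origin] by (simp add: field_simps)
qed

text \<open>Condition on the edges inside balls of radius \<open>n\<close>, then sum over all ways to split the
  large clusters of these balls into two unions that are joined by no edge.\<close>

lemma prob_large_clusters_unmerged:
  assumes "n \<le> k" "0 < L" "0 \<le> T" "0 < v"
  shows "prob {\<omega> \<in> space P. T + v \<le> real (card (vertices_in_large_clusters n k L \<omega>)) \<and>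
      (\<forall>y\<in>hball N k origin. real (card (ball_cluster N \<omega> k y)) \<le> T)}
    \<le> exp (N ^ k / L - (T / 2 * v - N ^ k * N ^ n) * (\<alpha> / max (real N) \<beta> ^ k))"
proof -
  let ?B = "hball N k origin"
  let ?I = "\<Union>x\<in>?B. ball_pairs n x"
  let ?J = "ball_pairs k origin - ?I"
  let ?q = "exp (- ((T / 2 * v - N ^ k * N ^ n) * (\<alpha> / max (real N) \<beta> ^ k)))"
  \<comment> \<open>A set \<open>a\<close> of revealed edges is read as a configuration. For fixed
    \<open>a\<close>, the large clusters and the family \<open>F a\<close> of candidate splits are
    deterministic, so a union bound over \<open>F a\<close> applies to the edges in
    \<open>?J\<close>.\<close>
  define W where "W a = vertices_in_large_clusters n k L (\<lambda>e. e \<in> a)" for a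
  define F where "F a = {\<S>. \<S> \<subseteq> ball_cluster N (\<lambda>e. e \<in> a) n ` W a \<and> \<Union>\<S> \<subseteq> W a \<and>
    T / 2 \<le> real (card (\<Union>\<S>)) \<and> v \<le> real (card (W a - \<Union>\<S>))}" for a
  define D where "D a \<S> = cross_pairs n (\<Union>\<S>) (W a - \<Union>\<S>)" for a \<S>
  let ?R = "\<lambda>a b. \<exists>\<S>\<in>F a. b \<inter> D a \<S> = {}"
  have lat: "x \<in> hlattice N" if "x \<in> ?B" for x using that hball_subset_hlattice by blast
  have finB: "finite ?B" by (rule finite_hball[OF N1 origin])
  have I: "finite ?I" "?I \<subseteq> pairs N"
    using finB finite_ball_pairs[OF lat] by simp (use ball_pairs_subset in blast)
  have J: "finite ?J" "?J \<subseteq> pairs N" and IJ: "?I \<inter> ?J = {}"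
    using finite_ball_pairs[OF origin] ball_pairs_subset by auto
  have WB: "W a \<subseteq> ?B" for a by (auto simp: W_def vertices_in_large_clusters_def)
  have finW: "finite (W a)" for a by (simp add: W_def)
  have finF: "finite (F a)" for a
    by (rule finite_subset[of _ "Pow (ball_cluster N (\<lambda>e. e \<in> a) n ` W a)"]) (use finW in \<open>auto simp: F_def\<close>)
  have DJ: "D a \<S> \<subseteq> ?J" if "\<S> \<in> F a" for a \<S>
  proof -
    have "D a \<S> \<subseteq> ball_pairs k origin"
      unfolding D_def by (rule cross_pairs_subset) (use that WB[of a] in \<open>auto simp: F_def\<close>)
    then show ?thesis using cross_pairs_disjoint[OF lat] unfolding D_def by blast
  qed
  have q: "prob {\<omega> \<in> space P. ?R a (edges N \<omega> \<inter> ?J)} \<le> exp (N ^ k / L) * ?q" for a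
  proof -
    have "{\<omega> \<in> space P. ?R a (edges N \<omega> \<inter> ?J)} = (\<Union>\<S>\<in>F a. {\<omega> \<in> space P. edges N \<omega> \<inter> ?J \<inter> D a \<S> = {}})"
      by blast
    then have "prob {\<omega> \<in> space P. ?R a (edges N \<omega> \<inter> ?J)} \<le>
        (\<Sum>\<S>\<in>F a. prob {\<omega> \<in> space P. edges N \<omega> \<inter> ?J \<inter> D a \<S> = {}})"
      using event_edges_Int[OF J(1), of "\<lambda>b. b \<inter> D a \<S> = {}" for \<S>]
      by (simp only:) (intro finite_measure_subadditive_finite finF, blast)
    also have "\<dots> \<le> (\<Sum>\<S>\<in>F a. ?q)"
    proof (rule sum_mono)
      fix \<S> assume \<S>: "\<S> \<in> F a"
      then have eq: "edges N \<omega> \<inter> ?J \<inter> D a \<S> = edges N \<omega> \<inter> D a \<S>" for \<omega> using DJ by blast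
      show "prob {\<omega> \<in> space P. edges N \<omega> \<inter> ?J \<inter> D a \<S> = {}} \<le> ?q"
        unfolding eq unfolding D_def
        by (rule prob_cross_pairs_closed) (use \<S> WB[of a] assms in \<open>auto simp: F_def\<close>)
    qed
    also have "\<dots> = real (card (F a)) * ?q" by simp
    also have "\<dots> \<le> exp (N ^ k / L) * ?q"
    proof (rule mult_right_mono)
      let ?\<C> = "ball_cluster N (\<lambda>e. e \<in> a) n ` W a"
      have "card (F a) \<le> card (Pow ?\<C>)"
        by (rule card_mono) (use finW in \<open>auto simp: F_def\<close>)
      also have "\<dots> = 2 ^ card ?\<C>" using finW by (intro card_Pow) simp
      finally have "real (card (F a)) \<le> 2 ^ card ?\<C>"
        by (metis of_nat_le_iff of_nat_numeral of_nat_power)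
      \<comment> \<open>Replacing 2 by \<open>exp 1\<close> puts the number of splits in the
        exponent, next to the cost of a single split.\<close>
      also have "\<dots> \<le> exp 1 ^ card ?\<C>"
        using exp_ge_add_one_self[of 1] by (intro power_mono) auto
      also have "\<dots> = exp (real (card ?\<C>))" by (simp add: exp_of_nat_mult[symmetric])
      also have "\<dots> \<le> exp (N ^ k / L)"
        using card_large_cluster_family_le[OF assms(2,1)] by (simp add: W_def)
      finally show "real (card (F a)) \<le> exp (N ^ k / L)" .
    qed simp
    finally show ?thesis .
  qed
  have "prob {\<omega> \<in> space P. T + v \<le> real (card (vertices_in_large_clusters n k L \<omega>)) \<and>
      (\<forall>y\<in>?B. real (card (ball_cluster N \<omega> k y)) \<le> T)}
    \<le> prob {\<omega> \<in> space P. ?R (edges N \<omega> \<inter> ?I) (edges N \<omega> \<inter> ?J)}"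
  proof (rule finite_measure_mono)
    show "{\<omega> \<in> space P. ?R (edges N \<omega> \<inter> ?I) (edges N \<omega> \<inter> ?J)} \<in> events"
      by (rule event_edges_Int_Int[OF I(1) J(1)])
    show "{\<omega> \<in> space P. T + v \<le> real (card (vertices_in_large_clusters n k L \<omega>)) \<and>
        (\<forall>y\<in>?B. real (card (ball_cluster N \<omega> k y)) \<le> T)}
      \<subseteq> {\<omega> \<in> space P. ?R (edges N \<omega> \<inter> ?I) (edges N \<omega> \<inter> ?J)}"
    proof safe
      fix \<omega> assume big: "T + v \<le> real (card (vertices_in_large_clusters n k L \<omega>))"
        and small: "\<forall>y\<in>?B. real (card (ball_cluster N \<omega> k y)) \<le> T"
      let ?a = "edges N \<omega> \<inter> ?I"
      have cl: "ball_cluster N (\<lambda>e. e \<in> ?a) n x = ball_cluster N \<omega> n x" if "x \<in> ?B" for x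
      proof -
        have "edges N (\<lambda>e. e \<in> ?a) \<inter> ball_pairs n x = edges N \<omega> \<inter> ball_pairs n x"
          using that unfolding edges_def by blast
        then show ?thesis by (simp only: ball_cluster_alt)
      qed
      then have W: "W ?a = vertices_in_large_clusters n k L \<omega>"
        unfolding W_def vertices_in_large_clusters_def by (intro Collect_cong conj_cong refl) simp
      have img: "ball_cluster N (\<lambda>e. e \<in> ?a) n ` W ?a = ball_cluster N \<omega> n ` W ?a"
        using cl WB[of ?a] by (intro image_cong refl) blast
      have "T < real (card (W ?a))" using big assms(4) W by simp
      from exists_cut[OF assms(1,3) this[unfolded W] small, folded W]
      obtain \<S> where \<S>: "\<S> \<subseteq> ball_cluster N \<omega> n ` W ?a" "\<Union>\<S> \<subseteq> W ?a"
        "T / 2 \<le> real (card (\<Union>\<S>))" "real (card (\<Union>\<S>)) \<le> T" "edges N \<omega> \<inter> D ?a \<S> = {}"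
        unfolding D_def by blast
      have "card (W ?a - \<Union>\<S>) = card (W ?a) - card (\<Union>\<S>)"
        by (rule card_Diff_subset) (rule finite_subset[OF \<S>(2) finW], rule \<S>(2))
      moreover have "card (\<Union>\<S>) \<le> card (W ?a)" by (rule card_mono[OF finW \<S>(2)])
      \<comment> \<open>Of at least \<open>T + v\<close> vertices, the chosen union takes at most
        \<open>T\<close>, which leaves \<open>v\<close> for the other side.\<close>
      ultimately have "v \<le> real (card (W ?a - \<Union>\<S>))" using big \<S>(4) W by simp
      then have "\<S> \<in> F ?a" unfolding F_def img using \<S> by blast
      moreover have "edges N \<omega> \<inter> ?J \<inter> D ?a \<S> = {}" using \<S>(5) by blast
      ultimately show "?R ?a (edges N \<omega> \<inter> ?J)" by blast
    qed
  qed
  also have "\<dots> = (\<Sum>a\<in>Pow ?I. prob {\<omega> \<in> space P. edges N \<omega> \<inter> ?I = a} * prob {\<omega> \<in> space P. ?R a (edges N \<omega> \<inter> ?J)})"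
    by (rule prob_edges_condition[OF I J IJ])
  also have "\<dots> \<le> (\<Sum>a\<in>Pow ?I. prob {\<omega> \<in> space P. edges N \<omega> \<inter> ?I = a} * (exp (N ^ k / L) * ?q))"
    by (intro sum_mono mult_left_mono q) simp
  also have "\<dots> = (\<Sum>a\<in>Pow ?I. prob {\<omega> \<in> space P. edges N \<omega> \<inter> ?I = a} * of_bool True) * (exp (N ^ k / L) * ?q)"
    by (simp add: sum_distrib_right)
  also have "(\<Sum>a\<in>Pow ?I. prob {\<omega> \<in> space P. edges N \<omega> \<inter> ?I = a} * of_bool True) = 1"
    by (subst sum_prob_edges_Int_eq[OF I, of "\<lambda>_. True", symmetric]) (simp add: prob_space)
  also have "1 * (exp (N ^ k / L) * ?q) = exp (N ^ k / L - (T / 2 * v - N ^ k * N ^ n) * (\<alpha> / max (real N) \<beta> ^ k))"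
    by (simp add: exp_add[symmetric] exp_diff exp_minus field_simps)
  finally show ?thesis .
qed

text \<open>The uniform choice is among clusters of the same maximal size: if some cluster exceeds
  \<open>t\<close>, all candidates do, and otherwise none does. The conditional probability is thus
  an indicator.\<close>

lemma measure_largest_cluster_law:
  "measure (largest_cluster_law N \<alpha> \<beta> k origin) {C. t < real (card C)} =
    prob {\<omega> \<in> space P. \<exists>y\<in>hball N k origin. t < real (card (ball_cluster N \<omega> k y))}"
proof -
  let ?S = "{C :: vertex set. t < real (card C)}"
  let ?E = "{\<omega> \<in> space P. \<exists>y\<in>hball N k origin. t < real (card (ball_cluster N \<omega> k y))}"
  let ?L = "\<lambda>\<omega>. largest_clusters N \<omega> k origin"
  have "measure (measure_pmf (pmf_of_set (?L \<omega>))) ?S = indicator ?E \<omega>" if \<omega>: "\<omega> \<in> space P" for \<omega>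
  proof -
    note L = largest_clusters_finite_nonempty[OF N1 origin, of \<omega> k]
    have m: "measure (measure_pmf (pmf_of_set (?L \<omega>))) ?S = card (?L \<omega> \<inter> ?S) / card (?L \<omega>)"
      by (rule measure_pmf_of_set[OF L(2,1)])
    show ?thesis
    proof (cases "\<omega> \<in> ?E")
      case True
      then obtain y where y: "y \<in> hball N k origin" "t < real (card (ball_cluster N \<omega> k y))" by blast
      have "t < real (card C)" if "C \<in> ?L \<omega>" for C
      proof -
        have "card (ball_cluster N \<omega> k y) \<le> card C" using that y(1) by (simp add: largest_clusters_def)
        then show ?thesis using y(2) by linarith
      qed
      then have "?L \<omega> \<inter> ?S = ?L \<omega>" by blast
      then show ?thesis using True L m by (simp add: card_gt_0_iff)
    next
      case False
      then have "?L \<omega> \<inter> ?S = {}" using \<omega> by (auto simp: largest_clusters_def)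
      then show ?thesis using False m by simp
    qed
  qed
  then have "(\<integral>\<omega>. measure (measure_pmf (pmf_of_set (?L \<omega>))) ?S \<partial>P) = expectation (indicator ?E)"
    by (rule Bochner_Integration.integral_cong[OF refl])
  also have "\<dots> = prob ?E" using event_large_cluster by simp
  finally show ?thesis
    unfolding largest_cluster_law_def
    by (subst subprob_space.measure_bind[OF prob_space_imp_subprob_space[OF prob_space_axioms]
          largest_cluster_kernel_measurable[OF N1 origin]]) simp_all
qed

text \<open>The constants are chosen in the order \<open>\<delta>\<close>, \<open>j\<close>,
  \<open>K\<close>; then \<open>n\<close> tends to infinity with \<open>k = n + j\<close>. The loss
  \<open>\<epsilon>\<close> splits into \<open>\<epsilon> / 4\<close> for the density at level
  \<open>n\<close>, \<open>\<epsilon> / 4\<close> for Chebyshev's inequality and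
  \<open>\<epsilon> / 2\<close> for the smaller side \<open>v\<close> of the cut.\<close>

lemma large_cluster_tendsto:
  assumes \<epsilon>: "0 < \<epsilon>" "\<epsilon> < \<theta> N \<alpha> \<beta>"
  shows "(\<lambda>k. prob {\<omega> \<in> space P. \<exists>y\<in>hball N k origin.
    (\<theta> N \<alpha> \<beta> - \<epsilon>) * real N ^ k < real (card (ball_cluster N \<omega> k y))}) \<longlonglongrightarrow> 1"
    (is "(\<lambda>k. prob (?E k)) \<longlonglongrightarrow> 1")
proof (rule order_tendstoI)
  show "\<forall>\<^sub>F k in sequentially. prob (?E k) < a" if "1 < a" for a
    using that by (intro always_eventually allI) (meson prob_le_1 order_le_less_trans)
next
  fix a :: real assume a: "a < 1"
  define b where "b = max (real N) \<beta>"
  define s where "s = b / N"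
  \<comment> \<open>Chosen so that \<open>T / 2 * v = 2 * \<delta> * X^2\<close> below: one half is
    reserved for the pairs inside radius-\<open>n\<close> balls.\<close>
  define \<delta> where "\<delta> = (\<theta> N \<alpha> \<beta> - \<epsilon>) * \<epsilon> / 8"
  have \<theta>: "0 < \<theta> N \<alpha> \<beta>" using \<epsilon> by linarith
  have \<alpha>0: "0 < \<alpha>" by (rule alpha_pos_if_theta_pos[OF \<theta>])
  have Npos: "0 < real N" "1 < real N" using N by auto
  have s1: "1 \<le> s" using Npos by (simp add: s_def b_def)
  \<comment> \<open>Here \<open>\<beta> < N^2\<close> enters: it gives \<open>s < N\<close>, so that
    \<open>(N / s) ^ k\<close> diverges.\<close>
  have "b < real N * real N"
    using beta_less_if_theta_pos[OF \<theta>] Npos by (simp add: b_def power2_eq_square)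
  then have sN: "s < real N" using Npos by (simp add: s_def divide_less_eq)
  have \<delta>: "0 < \<delta>" using \<epsilon> by (simp add: \<delta>_def)
  have "0 < min \<delta> ((1 - a) * \<epsilon>\<^sup>2 / 32)" using \<delta> a \<epsilon> by simp
  moreover have "1 / real N < 1" using Npos by simp
  \<comment> \<open>The first bound makes \<open>N ^ k * N ^ n\<close> less than
    \<open>\<delta> * X^2\<close>; the second makes the Chebyshev error
    \<open>16 * (1 / N) ^ j / \<epsilon>^2\<close> less than \<open>(1 - a) / 2\<close>.\<close>
  ultimately obtain j where j: "(1 / real N) ^ j < min \<delta> ((1 - a) * \<epsilon>\<^sup>2 / 32)"
    using real_arch_pow_inv by blast
  \<comment> \<open>With this \<open>K\<close> the entropy term \<open>N ^ k / L\<close> is exactly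
    half of \<open>\<alpha> * \<delta> * (N / s) ^ k\<close>, the guaranteed cost of a split. The
    factor \<open>s ^ j\<close> converts \<open>s ^ n\<close> into \<open>s ^ k\<close>.\<close>
  define K where "K = 2 * s ^ j / (\<alpha> * \<delta>)"
  have K: "0 < K" using s1 \<alpha>0 \<delta> by (simp add: K_def)
  let ?p = "\<lambda>n. prob {\<omega> \<in> space P. K * s ^ n < real (card (ball_cluster N \<omega> n origin))}"
  have "\<forall>\<^sub>F n in sequentially. \<theta> N \<alpha> \<beta> - \<epsilon> / 4 < ?p n"
    using prob_ball_cluster_large[of "\<epsilon> / 4" K] \<epsilon> by (simp add: s_def b_def)
  moreover have "\<forall>\<^sub>F n in sequentially. exp (- (\<alpha> * \<delta> / 2 * (N / s) ^ (n + j))) < (1 - a) / 2"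
  proof -
    have "(\<lambda>k. (s / N) ^ k) \<longlonglongrightarrow> 0" using s1 sN by (intro LIMSEQ_realpow_zero) simp_all
    then have "filterlim (\<lambda>k. inverse ((s / N) ^ k)) at_top sequentially"
      by (rule filterlim_inverse_at_top) (use s1 Npos in simp)
    then have "filterlim (\<lambda>k. (N / s) ^ k) at_top sequentially"
      by (simp add: power_inverse[symmetric])
    then have "filterlim (\<lambda>k. \<alpha> * \<delta> / 2 * (N / s) ^ k) at_top sequentially"
      using \<alpha>0 \<delta> by (intro filterlim_tendsto_pos_mult_at_top[OF tendsto_const]) simp_all
    then have "((\<lambda>k. exp (- (\<alpha> * \<delta> / 2 * (N / s) ^ k))) \<longlongrightarrow> 0) sequentially"
      by (intro filterlim_compose[OF exp_at_bot] filterlim_compose[OF filterlim_uminus_at_bot_at_top])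
    then have "\<forall>\<^sub>F k in sequentially. exp (- (\<alpha> * \<delta> / 2 * (N / s) ^ k)) < (1 - a) / 2"
      by (rule order_tendstoD) (use a in simp)
    then show ?thesis by (subst eventually_sequentially_seg)
  qed
  ultimately have "\<forall>\<^sub>F n in sequentially. a < prob (?E (n + j))"
  proof eventually_elim
    case (elim n)
    define k where "k = n + j"
    define L where "L = K * s ^ n"
    define X where "X = real N ^ k"
    define T where "T = (\<theta> N \<alpha> \<beta> - \<epsilon>) * X"
    define v where "v = \<epsilon> / 2 * X"
    let ?W = "\<lambda>\<omega>. real (card (vertices_in_large_clusters n k L \<omega>))"
    let ?B1 = "{\<omega> \<in> space P. ?W \<omega> \<le> (?p n - \<epsilon> / 4) * N ^ k}"
    let ?B2 = "{\<omega> \<in> space P. T + v \<le> ?W \<omega> \<and> (\<forall>y\<in>hball N k origin. real (card (ball_cluster N \<omega> k y)) \<le> T)}"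
    have X: "0 < X" using Npos by (simp add: X_def)
    have Xn: "real N ^ n = X * (1 / real N) ^ j"
      using Npos by (simp add: X_def k_def power_add power_one_over)
    have "prob ?B1 \<le> N ^ n / ((\<epsilon> / 4)\<^sup>2 * N ^ k)"
      unfolding L_def by (rule prob_few_vertices_in_large_clusters) (use \<epsilon> in simp)
    also have "\<dots> = (1 / real N) ^ j * 16 / \<epsilon>\<^sup>2"
      using X \<epsilon> unfolding of_nat_power Xn X_def[symmetric] by (simp add: power2_eq_square field_simps)
    also have "\<dots> < ((1 - a) * \<epsilon>\<^sup>2 / 32) * 16 / \<epsilon>\<^sup>2"
      using j \<epsilon> by (intro divide_strict_right_mono mult_strict_right_mono) simp_all
    also have "\<dots> = (1 - a) / 2" using \<epsilon> by simp
    finally have B1: "prob ?B1 < (1 - a) / 2" .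
    have bk: "b ^ k = s ^ k * X" using Npos by (simp add: s_def X_def power_divide)
    have NL: "real N ^ k / L = \<alpha> * \<delta> / 2 * (N / s) ^ k"
      using s1 \<alpha>0 \<delta> by (simp add: L_def K_def k_def power_add power_divide mult_ac)
    have "\<delta> * X\<^sup>2 * (\<alpha> / b ^ k) \<le> (T / 2 * v - N ^ k * N ^ n) * (\<alpha> / b ^ k)"
    proof (rule mult_right_mono)
      have "X * (X * (1 / real N) ^ j) \<le> X * (X * \<delta>)"
        using j X by (intro mult_left_mono) auto
      moreover have "T / 2 * v = 2 * (\<delta> * X\<^sup>2)"
        by (simp add: T_def v_def \<delta>_def power2_eq_square)
      ultimately show "\<delta> * X\<^sup>2 \<le> T / 2 * v - N ^ k * N ^ n"
        unfolding of_nat_mult of_nat_power Xn X_def[symmetric] by (simp add: power2_eq_square mult_ac)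
      show "0 \<le> \<alpha> / b ^ k" using \<alpha>0 Npos by (simp add: b_def)
    qed
    moreover have "\<delta> * X\<^sup>2 * (\<alpha> / b ^ k) = \<alpha> * \<delta> * (N / s) ^ k"
      unfolding bk using X s1 by (simp add: power2_eq_square power_divide X_def[symmetric])
    ultimately have expo: "real N ^ k / L - (T / 2 * v - N ^ k * N ^ n) * (\<alpha> / b ^ k)
        \<le> - (\<alpha> * \<delta> / 2 * (N / s) ^ k)"
      unfolding NL by (simp add: field_simps)
    have "prob ?B2 \<le> exp (N ^ k / L - (T / 2 * v - N ^ k * N ^ n) * (\<alpha> / max (real N) \<beta> ^ k))"
      by (rule prob_large_clusters_unmerged) (use K s1 \<epsilon> X in \<open>auto simp: k_def L_def T_def v_def\<close>)
    also have "\<dots> \<le> exp (- (\<alpha> * \<delta> / 2 * (N / s) ^ k))"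
      using expo by (simp add: b_def)
    also have "\<dots> < (1 - a) / 2" using elim(2) by (simp add: k_def)
    finally have B2: "prob ?B2 < (1 - a) / 2" .
    have W_cong: "vertices_in_large_clusters n k L \<omega> = vertices_in_large_clusters n k L \<omega>'"
      if "\<And>m y. m \<le> k \<Longrightarrow> y \<in> hball N k origin \<Longrightarrow> ball_cluster N \<omega> m y = ball_cluster N \<omega>' m y"
      for \<omega> \<omega>'
      using that by (auto simp: vertices_in_large_clusters_def k_def)
    have "?B1 \<in> events"
    proof (rule event_if_determined_by_ball[of k])
      fix \<omega> \<omega>'
      assume "\<And>m y. m \<le> k \<Longrightarrow> y \<in> hball N k origin \<Longrightarrow>
        ball_cluster N \<omega> m y = ball_cluster N \<omega>' m y"
      then have W: "vertices_in_large_clusters n k L \<omega> = vertices_in_large_clusters n k L \<omega>'"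
        by (rule W_cong)
      show "?W \<omega> \<le> (?p n - \<epsilon> / 4) * N ^ k \<longleftrightarrow> ?W \<omega>' \<le> (?p n - \<epsilon> / 4) * N ^ k"
        by (simp only: W)
    qed
    moreover have "?B2 \<in> events"
    proof (rule event_if_determined_by_ball[of k])
      fix \<omega> \<omega>'
      assume eq: "\<And>m y. m \<le> k \<Longrightarrow> y \<in> hball N k origin \<Longrightarrow>
        ball_cluster N \<omega> m y = ball_cluster N \<omega>' m y"
      have W: "vertices_in_large_clusters n k L \<omega> = vertices_in_large_clusters n k L \<omega>'"
        by (rule W_cong) (rule eq)
      show "(T + v \<le> ?W \<omega> \<and> (\<forall>y\<in>hball N k origin. real (card (ball_cluster N \<omega> k y)) \<le> T))
        \<longleftrightarrow> (T + v \<le> ?W \<omega>' \<and> (\<forall>y\<in>hball N k origin. real (card (ball_cluster N \<omega>' k y)) \<le> T))"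
        by (simp add: W eq)
    qed
    ultimately have ev: "?B1 \<in> events" "?B2 \<in> events" .
    \<comment> \<open>If no level-\<open>k\<close> cluster is large enough, either the large
      level-\<open>n\<close> clusters cover too little or they fail to merge. The two thresholds
      leave no gap because \<open>T + v = (\<theta> - \<epsilon> / 2) * X\<close> and
      \<open>?p n\<close> exceeds \<open>\<theta> - \<epsilon> / 4\<close>.\<close>
    have "space P - ?E k \<subseteq> ?B1 \<union> ?B2"
    proof
      fix \<omega> assume \<omega>: "\<omega> \<in> space P - ?E k"
      then have small: "\<forall>y\<in>hball N k origin. real (card (ball_cluster N \<omega> k y)) \<le> T"
        by (simp add: T_def X_def not_less)
      have "T + v = (\<theta> N \<alpha> \<beta> - \<epsilon> / 4 - \<epsilon> / 4) * X" by (simp add: T_def v_def algebra_simps)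
      also have "\<dots> \<le> (?p n - \<epsilon> / 4) * X" using elim(1) X by (intro mult_right_mono) auto
      finally have "T + v \<le> (?p n - \<epsilon> / 4) * N ^ k" by (simp add: X_def)
      then have "?W \<omega> \<le> (?p n - \<epsilon> / 4) * N ^ k \<or> T + v \<le> ?W \<omega>" by linarith
      then show "\<omega> \<in> ?B1 \<union> ?B2" using \<omega> small by blast
    qed
    then have "prob (space P - ?E k) \<le> prob (?B1 \<union> ?B2)"
      by (rule finite_measure_mono[OF _ sets.Un[OF ev]])
    also have "\<dots> \<le> prob ?B1 + prob ?B2" by (rule measure_Un_le[OF ev])
    also have "\<dots> < (1 - a) / 2 + (1 - a) / 2" by (rule add_strict_mono[OF B1 B2])
    also have "\<dots> = 1 - a" by simp
    finally have "prob (space P - ?E k) < 1 - a" .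
    then show ?case using prob_compl[OF event_large_cluster] by (simp add: k_def)
  qed
  \<comment> \<open>A shift by the fixed \<open>j\<close> does not affect eventual
    statements.\<close>
  then show "\<forall>\<^sub>F k in sequentially. a < prob (?E k)" by (subst (asm) eventually_sequentially_seg)
qed

end

theorem theorem5:
  fixes N :: nat and \<alpha> \<beta> \<epsilon> :: real
  assumes "N \<ge> 2" and "0 \<le> \<alpha>" and "0 < \<beta>"
    and "\<theta> N \<alpha> \<beta> > 0"
    and "\<epsilon> > 0"
  shows "(\<lambda>k. measure (largest_cluster_law N \<alpha> \<beta> k origin)
            {C. real (card C) > (\<theta> N \<alpha> \<beta> - \<epsilon>) * real N ^ k}) \<longlonglongrightarrow> 1"
proof -
  interpret hierarchical_percolation N \<alpha> \<beta> by unfold_locales (use assms in auto)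
  \<comment> \<open>An \<open>\<epsilon>\<close> at or above \<theta> is replaced by
    \<open>\<theta> / 2\<close>, so that the target volume stays positive. Lowering
    \<open>\<epsilon>\<close> raises the threshold, so the limit 1 for the smaller value forces it
    for the original one.\<close>
  let ?\<epsilon> = "min \<epsilon> (\<theta> N \<alpha> \<beta> / 2)"
  let ?m = "\<lambda>\<epsilon> k. measure (largest_cluster_law N \<alpha> \<beta> k origin)
            {C. real (card C) > (\<theta> N \<alpha> \<beta> - \<epsilon>) * real N ^ k}"
  have lim: "?m ?\<epsilon> \<longlonglongrightarrow> 1"
    unfolding measure_largest_cluster_law by (rule large_cluster_tendsto) (use assms in auto)
  have "?m ?\<epsilon> k \<le> ?m \<epsilon> k" for k
    unfolding measure_largest_cluster_law
  proof (rule finite_measure_mono[OF _ event_large_cluster])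
    have "(\<theta> N \<alpha> \<beta> - \<epsilon>) * real N ^ k \<le> (\<theta> N \<alpha> \<beta> - ?\<epsilon>) * real N ^ k"
      by (intro mult_right_mono) auto
    then show "{\<omega> \<in> space P. \<exists>y\<in>hball N k origin.
          (\<theta> N \<alpha> \<beta> - ?\<epsilon>) * real N ^ k < real (card (ball_cluster N \<omega> k y))}
        \<subseteq> {\<omega> \<in> space P. \<exists>y\<in>hball N k origin.
          (\<theta> N \<alpha> \<beta> - \<epsilon>) * real N ^ k < real (card (ball_cluster N \<omega> k y))}"
      by (blast intro: order_le_less_trans)
  qed
  moreover have "?m \<epsilon> k \<le> 1" for k unfolding measure_largest_cluster_law by (rule prob_le_1)
  ultimately show ?thesis by (intro tendsto_sandwich[OF _ _ lim tendsto_const]) auto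
qed

end
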